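(* Let $\alpha>0$ be real and let $2\leq k\leq n$ be integers. Let $f$ be one of $f_\alpha,\phi_\alpha,\psi_\alpha$, and let $I=[0,\infty)$ if $f=f_\alpha$ and $I=\mathbb{R}$ otherwise. Then $f$ is Loewner convex on $\mathbb{P}_n^k(I)$ if and only if $f$ is Loewner super-additive on $\mathbb{P}_n^k(I)$.
   Context: $\mathbb{P}_n(I)$ is the set of real symmetric positive semidefinite $n\times n$ matrices with entries in $I$; $\mathbb{P}_n:=\mathbb{P}_n(\mathbb{R})$; $\mathbb{P}_n^k(I)$ is the set of matrices in $\mathbb{P}_n(I)$ of rank at most $k$. $A\geq B$ means $A-B\in\mathbb{P}_n$. For a function $f$ and a matrix $A=(a_{ij})$, $f[A]:=(f(a_{ij}))$. For $\alpha>0$: $f_\alpha(x):=x^\alpha$ for $x\ge 0$; $\phi_\alpha(x):=|x|^\alpha$ and $\psi_\alpha(x):=\operatorname{sign}(x)|x|^\alpha$ for $x\in\mathbb{R}$ (all equal to $0$ at $x=0$). The function $f$ is Loewner convex on $V$ if $f[\lambda A+(1-\lambda)B]\leq\lambda f[A]+(1-\lambda)f[B]$ for all $0\leq\lambda\leq1$ and all $A,B\in V$ with $A\geq B\geq0$; it is Loewner super-additive on $V$ if $f[A+B]\geq f[A]+f[B]$ for all $A,B\in V$ for which $f[A+B]$ is defined. *)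

theory Defs
  imports "HOL-Analysis.Analysis"
begin

definition psd_matrices :: "real set \<Rightarrow> (real ^ 'n ^ 'n) set" where
  "psd_matrices I =
     {A. transpose A = A \<and> (\<forall>x. 0 \<le> x \<bullet> (A *v x)) \<and> (\<forall>i j. A $ i $ j \<in> I)}"

definition psd_matrices_rank :: "nat \<Rightarrow> real set \<Rightarrow> (real ^ 'n ^ 'n) set" where
  "psd_matrices_rank k I = {A \<in> psd_matrices I. rank A \<le> k}"

definition loewner_le :: "real ^ 'n ^ 'n \<Rightarrow> real ^ 'n ^ 'n \<Rightarrow> bool" where
  "loewner_le B A \<longleftrightarrow> A - B \<in> psd_matrices UNIV"

(* The mathematical f_pow is defined on [0,oo) only; its values at negative
   arguments are irrelevant junk. Note that 0 powr a = 0 for every a. *)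
definition f_pow :: "real \<Rightarrow> real \<Rightarrow> real" where
  "f_pow \<alpha> x = x powr \<alpha>"

definition phi_pow :: "real \<Rightarrow> real \<Rightarrow> real" where
  "phi_pow \<alpha> x = \<bar>x\<bar> powr \<alpha>"

definition psi_pow :: "real \<Rightarrow> real \<Rightarrow> real" where
  "psi_pow \<alpha> x = sgn x * \<bar>x\<bar> powr \<alpha>"

definition loewner_convex_on :: "(real ^ 'n ^ 'n) set \<Rightarrow> (real \<Rightarrow> real) \<Rightarrow> bool" where
  "loewner_convex_on V f \<longleftrightarrow>
     (\<forall>A\<in>V. \<forall>B\<in>V. \<forall>t\<in>{0..1}. loewner_le B A \<longrightarrow> loewner_le 0 B \<longrightarrow>
        loewner_le (map_matrix f (t *\<^sub>R A + (1 - t) *\<^sub>R B))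
                   (t *\<^sub>R map_matrix f A + (1 - t) *\<^sub>R map_matrix f B))"

(* I is the domain of f: applying f entrywise to A + B is defined iff
   all entries of A + B lie in I. The sum A + B need not lie in V. *)
definition loewner_super_additive_on ::
    "real set \<Rightarrow> (real ^ 'n ^ 'n) set \<Rightarrow> (real \<Rightarrow> real) \<Rightarrow> bool" where
  "loewner_super_additive_on I V f \<longleftrightarrow>
     (\<forall>A\<in>V. \<forall>B\<in>V. (\<forall>i j. (A + B) $ i $ j \<in> I) \<longrightarrow>
        loewner_le (map_matrix f A + map_matrix f B) (map_matrix f (A + B)))"

end

theory Submission
  imports Defs "HOL-Computational_Algebra.Polynomial"
begin

text \<open>
  Both properties hold when \<open>f\<close> is a monomial \<open>x ^ m\<close> on \<open>I\<close> or \<open>\<alpha> \<ge> n\<close>, and both fail otherwise.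

  Monomials are handled by the Schur product theorem. For \<open>\<alpha> > n\<close> a quadratic form of
  \<open>f[B + t D]\<close> is differentiated in \<open>t\<close>: the derivative is monotone because entrywise powers with
  exponent above \<open>n - 1\<close> are Loewner monotone, which in turn rests on the theorem of FitzGerald and Horn
  that exponents above \<open>n - 2\<close> preserve positivity. The case \<open>\<alpha> = n\<close> is a limit.

  For \<open>\<alpha> < n\<close> put \<open>m = \<lfloor>\<alpha>\<rfloor>\<close>. Convexity is tested at \<open>A = 1 1\<^sup>T + e y y\<^sup>T\<close>,
  \<open>B = e y y\<^sup>T\<close>, \<open>t = 1/2\<close>, and super-additivity at \<open>A = 1 1\<^sup>T\<close>, \<open>B = e y y\<^sup>T\<close>. A vector
  \<open>w\<close> annihilating suitable powers of \<open>y\<close> (divided difference weights) removes the low order terms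
  of the binomial series of \<open>(1 + e y\<^sub>i y\<^sub>j) powr \<alpha>\<close>, and as \<open>e \<rightarrow> 0\<close> the leading term
  of the quadratic form is negative unless \<open>f\<close> is a monomial.
\<close>

section \<open>Positive semidefinite kernels on a finite index set\<close>

text \<open>Finite index sets and kernels, in place of matrix types, permit induction on the index
  set and restriction to principal blocks within a single type.\<close>

definition qform :: "'a set \<Rightarrow> ('a \<Rightarrow> 'a \<Rightarrow> real) \<Rightarrow> ('a \<Rightarrow> real) \<Rightarrow> real" where
  "qform S A x = (\<Sum>i\<in>S. \<Sum>j\<in>S. x i * x j * A i j)"

definition psd_on :: "'a set \<Rightarrow> ('a \<Rightarrow> 'a \<Rightarrow> real) \<Rightarrow> bool" where
  "psd_on S A \<longleftrightarrow> (\<forall>i\<in>S. \<forall>j\<in>S. A i j = A j i) \<and> (\<forall>x. 0 \<le> qform S A x)"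

lemma psd_onI:
  assumes "\<And>i j. i \<in> S \<Longrightarrow> j \<in> S \<Longrightarrow> A i j = A j i" "\<And>x. 0 \<le> qform S A x"
  shows "psd_on S A"
  using assms by (auto simp: psd_on_def)

lemma psd_on_sym: "psd_on S A \<Longrightarrow> i \<in> S \<Longrightarrow> j \<in> S \<Longrightarrow> A i j = A j i"
  by (auto simp: psd_on_def)

lemma qform_nonneg: "psd_on S A \<Longrightarrow> 0 \<le> qform S A x"
  by (auto simp: psd_on_def)

lemma qform_cong:
  "(\<And>i j. i \<in> S \<Longrightarrow> j \<in> S \<Longrightarrow> A i j = B i j) \<Longrightarrow> qform S A x = qform S B x"
  by (simp add: qform_def)

lemma qform_add: "qform S (\<lambda>i j. A i j + B i j) x = qform S A x + qform S B x"
  by (simp add: qform_def sum.distrib algebra_simps)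

lemma qform_diff: "qform S (\<lambda>i j. A i j - B i j) x = qform S A x - qform S B x"
  by (simp add: qform_def sum_subtractf algebra_simps)

lemma qform_scale: "qform S (\<lambda>i j. c * A i j) x = c * qform S A x"
  by (simp add: qform_def sum_distrib_left algebra_simps)

lemma qform_rank1: "qform S (\<lambda>i j. u i * u j) x = (\<Sum>i\<in>S. x i * u i)\<^sup>2"
  by (simp add: qform_def power2_eq_square sum_product algebra_simps)

lemma psd_on_add: "psd_on S A \<Longrightarrow> psd_on S B \<Longrightarrow> psd_on S (\<lambda>i j. A i j + B i j)"
  by (auto simp: psd_on_def qform_add)

lemma psd_on_scale: "0 \<le> c \<Longrightarrow> psd_on S A \<Longrightarrow> psd_on S (\<lambda>i j. c * A i j)"
  by (auto simp: psd_on_def qform_scale)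

lemma psd_on_rank1: "psd_on S (\<lambda>i j. u i * u j)"
  by (auto simp: psd_on_def qform_rank1)

text \<open>Congruence by a diagonal matrix: the factors \<open>u i\<close> are absorbed into the
  test vector.\<close>

lemma psd_on_rescale:
  assumes "psd_on S A"
  shows "psd_on S (\<lambda>i j. u i * u j * A i j)"
proof (rule psd_onI)
  fix x
  have "qform S (\<lambda>i j. u i * u j * A i j) x = qform S A (\<lambda>i. x i * u i)"
    unfolding qform_def by (intro sum.cong refl) (simp only: ac_simps)
  then show "0 \<le> qform S (\<lambda>i j. u i * u j * A i j) x"
    using qform_nonneg[OF assms] by simp
qed (simp add: psd_on_sym[OF assms])

lemma psd_on_subset:
  assumes "psd_on S A" "T \<subseteq> S" "finite S"
  shows "psd_on T A"
proof (rule psd_onI)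
  fix x
  have "qform T A x = qform S A (\<lambda>i. if i \<in> T then x i else 0)"
    unfolding qform_def
    by (rule sum.mono_neutral_cong_left[OF assms(3,2)], simp,
        rule sum.mono_neutral_cong_left[OF assms(3,2)]) auto
  then show "0 \<le> qform T A x" using qform_nonneg[OF assms(1)] by simp
qed (use assms(2) psd_on_sym[OF assms(1)] in auto)

lemma qform_insert_zero:
  assumes "finite S" "k \<notin> S" "\<forall>i\<in>insert k S. A i k = 0 \<and> A k i = 0"
  shows "qform (insert k S) A x = qform S A x"
  using assms by (simp add: qform_def)

text \<open>Counterpart of \<open>psd_on_subset\<close>: once a Schur complement has cleared row and
  column \<open>k\<close>, positivity can be carried back from the smaller block.\<close>

lemma psd_on_insert_zero:
  assumes "finite S" "k \<notin> S" "\<forall>i\<in>insert k S. A i k = 0 \<and> A k i = 0" "psd_on S A"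
  shows "psd_on (insert k S) A"
proof (rule psd_onI)
  fix x
  show "0 \<le> qform (insert k S) A x"
    using qform_nonneg[OF assms(4), of x] qform_insert_zero[OF assms(1-3), of x] by simp
qed (use assms(3) psd_on_sym[OF assms(4)] in auto)

section \<open>Discriminants, Cauchy-Schwarz and Schur complements\<close>

lemma quadratic_nonneg_discriminant:
  fixes a b c :: real
  assumes "\<And>s. 0 \<le> a + 2 * s * b + s\<^sup>2 * c"
  shows "b\<^sup>2 \<le> a * c"
proof (cases "c = 0")
  case True
  have "b = 0"
  proof (rule ccontr)
    assume b: "b \<noteq> 0"
    \<comment> \<open>At this \<open>s\<close> the affine function takes the value -1.\<close>
    have "0 \<le> a + 2 * (- (a + 1) / (2 * b)) * b" using assms[of "- (a + 1) / (2 * b)"] True by simp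
    then show False using b by (simp add: field_simps)
  qed
  then show ?thesis using True by simp
next
  case False
  have c: "c > 0"
  proof (rule ccontr)
    assume "\<not> c > 0"
    then have c: "c < 0" using False by simp
    \<comment> \<open>Large enough for \<open>s * (- c)\<close> to exceed
      \<open>\<bar>a\<bar> + 2 * \<bar>b\<bar>\<close>; the last summand gives
      \<open>s \<ge> 1\<close>, so that \<open>a\<close> is bounded by
      \<open>s * \<bar>a\<bar>\<close>.\<close>
    define s where "s = (\<bar>a\<bar> + 2 * \<bar>b\<bar> + 1) / (- c) + 1"
    have s1: "s \<ge> 1" using c by (simp add: s_def field_simps)
    have "s * (- c) = \<bar>a\<bar> + 2 * \<bar>b\<bar> + 1 - c" using c by (simp add: s_def field_simps)
    then have "s * (s * (- c)) > s * (\<bar>a\<bar> + 2 * \<bar>b\<bar>)" using s1 c by (intro mult_strict_left_mono) auto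
    moreover have "s * \<bar>a\<bar> \<ge> a" using mult_right_mono[OF s1, of "\<bar>a\<bar>"] by linarith
    moreover have "s * \<bar>b\<bar> \<ge> s * b" using s1 by (intro mult_left_mono) auto
    ultimately show False using assms[of s] by (simp add: algebra_simps power2_eq_square)
  qed
  \<comment> \<open>Evaluation at the minimiser \<open>- b / c\<close>.\<close>
  have "0 \<le> a + 2 * (- b / c) * b + (- b / c)\<^sup>2 * c" by (rule assms)
  also have "\<dots> = a - b\<^sup>2 / c" using c by (simp add: field_simps power2_eq_square)
  finally show ?thesis using c by (simp add: field_simps)
qed

text \<open>Moving \<open>x\<close> along the unit vector at \<open>k\<close> makes the form a
  nonnegative quadratic polynomial in the step \<open>s\<close>; its discriminant gives the
  inequality.\<close>

lemma psd_on_cauchy_schwarz: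
  assumes psd: "psd_on S A" and fin: "finite S" and k: "k \<in> S"
  shows "(\<Sum>i\<in>S. x i * A i k)\<^sup>2 \<le> qform S A x * A k k"
proof (rule quadratic_nonneg_discriminant)
  fix s
  define e where "e = (\<lambda>i. if i = k then 1 else 0 :: real)"
  have e: "(\<Sum>j\<in>S. e j * g j) = g k" for g
    using fin k by (simp add: e_def mult_delta_left)
  have "0 \<le> qform S A (\<lambda>i. x i + s * e i)" by (rule qform_nonneg[OF psd])
  also have "\<dots> = qform S A x + s * (\<Sum>i\<in>S. x i * (\<Sum>j\<in>S. e j * A i j))
      + s * (\<Sum>i\<in>S. e i * (\<Sum>j\<in>S. x j * A i j)) + s\<^sup>2 * (\<Sum>i\<in>S. e i * (\<Sum>j\<in>S. e j * A i j))"
    unfolding qform_def sum_distrib_left sum.distrib[symmetric]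
    by (intro sum.cong refl) (simp add: algebra_simps power2_eq_square)
  also have "\<dots> = qform S A x + s * (\<Sum>i\<in>S. x i * A i k) + s * (\<Sum>j\<in>S. x j * A k j) + s\<^sup>2 * A k k"
    unfolding e ..
  also have "(\<Sum>j\<in>S. x j * A k j) = (\<Sum>i\<in>S. x i * A i k)"
    by (intro sum.cong refl) (simp add: psd_on_sym[OF psd k])
  finally show "0 \<le> qform S A x + 2 * s * (\<Sum>i\<in>S. x i * A i k) + s\<^sup>2 * A k k" by simp
qed

lemma psd_on_diag_nonneg:
  assumes "psd_on S A" "k \<in> S" "finite S"
  shows "0 \<le> A k k"
proof -
  have "psd_on {k} A" by (rule psd_on_subset[OF assms(1)]) (use assms in auto)
  from qform_nonneg[OF this, of "\<lambda>_. 1"] show ?thesis by (simp add: qform_def)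
qed

text \<open>Cauchy-Schwarz with the unit vector at \<open>i\<close> as test vector.\<close>

lemma psd_on_entry_square_le:
  assumes "psd_on S A" "finite S" "i \<in> S" "j \<in> S"
  shows "(A i j)\<^sup>2 \<le> A i i * A j j"
proof -
  define e where "e = (\<lambda>l. if l = i then 1 else 0 :: real)"
  have e: "(\<Sum>l\<in>S. e l * g l) = g i" for g
    using assms(2,3) by (simp add: e_def mult_delta_left)
  have "qform S A e = (\<Sum>l\<in>S. e l * (\<Sum>j\<in>S. e j * A l j))"
    by (simp add: qform_def sum_distrib_left mult.assoc)
  then show ?thesis using psd_on_cauchy_schwarz[OF assms(1,2,4), of e] by (simp add: e)
qed

text \<open>The witness is column \<open>k\<close> divided by \<open>sqrt (A k k)\<close>; division by zero makes it \<open>0\<close>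
  exactly when that column vanishes.\<close>

lemma psd_on_schur_complement:
  assumes psd: "psd_on S A" and fin: "finite S" and k: "k \<in> S"
  obtains z where "psd_on S (\<lambda>i j. A i j - z i * z j)"
    "\<And>i. i \<in> S \<Longrightarrow> A i k = z i * z k" "\<And>i. i \<in> S \<Longrightarrow> A k i = z k * z i"
proof
  define z where "z = (\<lambda>i. A i k / sqrt (A k k))"
  have nn: "0 \<le> A k k" by (rule psd_on_diag_nonneg[OF psd k fin])
  show col: "A i k = z i * z k" if i: "i \<in> S" for i
  proof (cases "A k k = 0")
    case True
    then have "A i k = 0" using psd_on_entry_square_le[OF psd fin i k] by simp
    then show ?thesis by (simp add: z_def)
  next
    case False
    then show ?thesis using nn by (simp add: z_def)
  qed
  then show "A k i = z k * z i" if "i \<in> S" for i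
    using psd_on_sym[OF psd k that] that by simp
  show "psd_on S (\<lambda>i j. A i j - z i * z j)"
  proof (rule psd_onI)
    fix x
    \<comment> \<open>Positivity of the complement is Cauchy-Schwarz divided by
      \<open>A k k\<close>; if that entry is 0, the quotient is 0 too.\<close>
    have "(\<Sum>i\<in>S. x i * z i)\<^sup>2 = (\<Sum>i\<in>S. x i * A i k)\<^sup>2 / A k k"
      using nn by (simp add: z_def sum_divide_distrib[symmetric] power_divide)
    also have "\<dots> \<le> qform S A x"
    proof (cases "A k k = 0")
      case False
      then show ?thesis using nn psd_on_cauchy_schwarz[OF psd fin k, of x] by (simp add: field_simps)
    qed (simp add: qform_nonneg[OF psd])
    finally show "0 \<le> qform S (\<lambda>i j. A i j - z i * z j) x" by (simp add: qform_diff qform_rank1)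
  qed (simp add: psd_on_sym[OF psd])
qed

section \<open>Schur products and integer powers\<close>

lemma psd_on_schur_product:
  assumes "finite S" "psd_on S A" "psd_on S B"
  shows "psd_on S (\<lambda>i j. A i j * B i j)"
  using assms
proof (induction S arbitrary: A rule: finite_induct)
  case empty
  then show ?case by (simp add: psd_on_def qform_def)
next
  case (insert k S)
  obtain z where z: "psd_on (insert k S) (\<lambda>i j. A i j - z i * z j)"
    "\<And>i. i \<in> insert k S \<Longrightarrow> A i k = z i * z k" "\<And>i. i \<in> insert k S \<Longrightarrow> A k i = z k * z i"
    using psd_on_schur_complement[OF insert.prems(1), of k] insert.hyps by auto
  \<comment> \<open>\<open>A\<close> splits into a remainder with vanishing row and column
    \<open>k\<close>, which the induction hypothesis handles on \<open>S\<close>, and a rank one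
    part, whose product with \<open>B\<close> is a rescaling of \<open>B\<close>.\<close>
  have "psd_on S (\<lambda>i j. (A i j - z i * z j) * B i j)"
    using psd_on_subset[OF z(1), of S] psd_on_subset[OF insert.prems(2), of S] insert by auto
  then have 1: "psd_on (insert k S) (\<lambda>i j. (A i j - z i * z j) * B i j)"
    by (intro psd_on_insert_zero) (use insert z in auto)
  have 2: "psd_on (insert k S) (\<lambda>i j. z i * z j * B i j)"
    by (rule psd_on_rescale[OF insert.prems(2)])
  show ?case using psd_on_add[OF 1 2] by (simp add: left_diff_distrib)
qed

lemma psd_on_power:
  assumes "finite S" "psd_on S A"
  shows "psd_on S (\<lambda>i j. A i j ^ m)"
proof (induction m)
  case 0
  show ?case using psd_on_rank1[of S "\<lambda>_. 1"] by simp
next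
  case (Suc m)
  then show ?case using psd_on_schur_product[OF assms] by simp
qed

text \<open>Induction by the product rule for differences: A^(m+1) - B^(m+1) = A (A^m - B^m) + (A -
  B) B^m, all products entrywise.\<close>

lemma psd_on_power_mono:
  assumes fin: "finite S" and AB: "psd_on S (\<lambda>i j. A i j - B i j)" and B: "psd_on S B"
  shows "psd_on S (\<lambda>i j. A i j ^ m - B i j ^ m)"
proof (induction m)
  case 0
  show ?case using psd_on_rank1[of S "\<lambda>_. 0"] by simp
next
  case (Suc m)
  have A: "psd_on S A" using psd_on_add[OF AB B] by simp
  have "psd_on S (\<lambda>i j. A i j * (A i j ^ m - B i j ^ m) + (A i j - B i j) * B i j ^ m)"
    by (intro psd_on_add psd_on_schur_product psd_on_power fin A AB B Suc)
  then show ?case by (simp add: algebra_simps)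
qed

text \<open>The defect at exponent m+1 is \<open>A + B\<close> times the defect at m, plus the mixed
  terms A B^m and B A^m.\<close>

lemma psd_on_power_superadditive:
  assumes fin: "finite S" and A: "psd_on S A" and B: "psd_on S B" and m: "1 \<le> m"
  shows "psd_on S (\<lambda>i j. (A i j + B i j) ^ m - (A i j ^ m + B i j ^ m))"
  using m
proof (induction m rule: dec_induct)
  case base
  show ?case using psd_on_rank1[of S "\<lambda>_. 0"] by simp
next
  case (step m)
  have "psd_on S (\<lambda>i j. (A i j + B i j) * ((A i j + B i j) ^ m - (A i j ^ m + B i j ^ m))
     + (A i j * B i j ^ m + B i j * A i j ^ m))"
    by (intro psd_on_add psd_on_schur_product psd_on_power fin A B step.IH)
  then show ?case by (simp add: algebra_simps)
qed

text \<open>The convexity defect at exponent m+1 is the convex combination times the defect at m,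
  plus t (1 - t) (A - B) (A^m - B^m), where monotonicity of powers applies.\<close>

lemma psd_on_power_convex:
  assumes fin: "finite S" and AB: "psd_on S (\<lambda>i j. A i j - B i j)" and B: "psd_on S B"
    and t: "0 \<le> t" "t \<le> 1" and m: "1 \<le> m"
  shows "psd_on S (\<lambda>i j. t * A i j ^ m + (1 - t) * B i j ^ m - (t * A i j + (1 - t) * B i j) ^ m)"
  using m
proof (induction m rule: dec_induct)
  case base
  show ?case using psd_on_rank1[of S "\<lambda>_. 0"] by simp
next
  case (step m)
  have A: "psd_on S A" using psd_on_add[OF AB B] by simp
  have "psd_on S (\<lambda>i j. (t * A i j + (1 - t) * B i j) *
       (t * A i j ^ m + (1 - t) * B i j ^ m - (t * A i j + (1 - t) * B i j) ^ m)
     + t * ((1 - t) * ((A i j - B i j) * (A i j ^ m - B i j ^ m))))"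
    by (intro psd_on_add psd_on_schur_product psd_on_scale psd_on_power_mono fin A B AB step.IH) (use t in auto)
  then show ?case by (simp add: algebra_simps)
qed

section \<open>Powers above the critical exponent\<close>

lemma phi_pow_mult: "phi_pow \<alpha> (x * y) = phi_pow \<alpha> x * phi_pow \<alpha> y"
  by (simp add: phi_pow_def abs_mult powr_mult)

lemma psi_pow_mult: "psi_pow \<alpha> (x * y) = psi_pow \<alpha> x * psi_pow \<alpha> y"
  by (simp add: psi_pow_def abs_mult powr_mult sgn_mult)

lemma phi_pow_nonneg_arg: "0 \<le> x \<Longrightarrow> phi_pow \<alpha> x = x powr \<alpha>"
  by (simp add: phi_pow_def)

lemma psi_pow_nonneg_arg: "0 \<le> x \<Longrightarrow> psi_pow \<alpha> x = x powr \<alpha>"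
  by (simp add: psi_pow_def sgn_if)

lemma phi_pow_uminus: "phi_pow \<alpha> (- x) = phi_pow \<alpha> x"
  by (simp add: phi_pow_def)

lemma psi_pow_uminus: "psi_pow \<alpha> (- x) = - psi_pow \<alpha> x"
  by (simp add: psi_pow_def sgn_minus)

lemma has_real_derivative_powr_on_half_line:
  assumes f: "\<And>x. 0 < x \<Longrightarrow> f x = x powr \<alpha>" and x: "0 < x"
  shows "(f has_real_derivative \<alpha> * x powr (\<alpha> - 1)) (at x)"
proof (rule has_field_derivative_transform_within_open)
  show "((\<lambda>x. x powr \<alpha>) has_real_derivative \<alpha> * x powr (\<alpha> - 1)) (at x)"
    using x by (rule has_real_derivative_powr)
  show "open {0::real<..}" by simp
qed (use f x in auto)

text \<open>The difference quotient at 0 is at most \<open>\<bar>h\<bar> powr (\<alpha> - 1)\<close>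
  in absolute value.\<close>

lemma has_real_derivative_zero_of_powr_bound:
  fixes f :: "real \<Rightarrow> real"
  assumes f: "\<And>x. \<bar>f x\<bar> \<le> \<bar>x\<bar> powr \<alpha>" and \<alpha>: "1 < \<alpha>"
  shows "(f has_real_derivative 0) (at 0)"
proof -
  have f0: "f 0 = 0" using f[of 0] by simp
  have "((\<lambda>h. \<bar>h::real\<bar> powr (\<alpha> - 1)) \<longlongrightarrow> 0) (at 0)"
    by (rule tendsto_zero_powrI[where b = "\<alpha> - 1"]) (use \<alpha> in \<open>auto intro!: tendsto_eq_intros\<close>)
  then have "((\<lambda>h. f h / h) \<longlongrightarrow> 0) (at 0)"
  proof (rule Lim_null_comparison[rotated])
    have "norm (f h / h) \<le> \<bar>h\<bar> powr (\<alpha> - 1)" if "h \<noteq> 0" for h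
      using f[of h] that by (simp add: powr_diff divide_right_mono)
    then show "\<forall>\<^sub>F h in at 0. norm (f h / h) \<le> \<bar>h\<bar> powr (\<alpha> - 1)"
      by (auto simp: eventually_at_filter)
  qed
  then show ?thesis by (simp add: DERIV_def f0)
qed

lemma phi_pow_has_real_derivative:
  assumes "1 < \<alpha>"
  shows "(phi_pow \<alpha> has_real_derivative \<alpha> * psi_pow (\<alpha> - 1) x) (at x)"
proof -
  have pos: "(phi_pow \<alpha> has_real_derivative \<alpha> * x powr (\<alpha> - 1)) (at x)" if "0 < x" for x
    by (rule has_real_derivative_powr_on_half_line) (use that in \<open>auto simp: phi_pow_def\<close>)
  consider "x > 0" | "x < 0" | "x = 0" by linarith
  then show ?thesis
  proof cases
    case 2
    have "((\<lambda>y. phi_pow \<alpha> (- y)) has_real_derivative (\<alpha> * (- x) powr (\<alpha> - 1)) * (- 1)) (at x)"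
      by (rule DERIV_chain2[OF pos]) (use 2 in \<open>auto intro!: derivative_eq_intros\<close>)
    then show ?thesis using 2 by (simp add: phi_pow_uminus psi_pow_def)
  next
    case 3
    have "(phi_pow \<alpha> has_real_derivative 0) (at 0)"
      by (rule has_real_derivative_zero_of_powr_bound[OF _ assms]) (simp add: phi_pow_def)
    then show ?thesis using 3 by (simp add: psi_pow_def)
  qed (use pos in \<open>auto simp: psi_pow_def\<close>)
qed

lemma psi_pow_has_real_derivative:
  assumes "1 < \<alpha>"
  shows "(psi_pow \<alpha> has_real_derivative \<alpha> * phi_pow (\<alpha> - 1) x) (at x)"
proof -
  have pos: "(psi_pow \<alpha> has_real_derivative \<alpha> * x powr (\<alpha> - 1)) (at x)" if "0 < x" for x
    by (rule has_real_derivative_powr_on_half_line) (use that in \<open>auto simp: psi_pow_def\<close>)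
  consider "x > 0" | "x < 0" | "x = 0" by linarith
  then show ?thesis
  proof cases
    case 2
    have "((\<lambda>y. - psi_pow \<alpha> (- y)) has_real_derivative - ((\<alpha> * (- x) powr (\<alpha> - 1)) * (- 1))) (at x)"
      by (rule DERIV_minus[OF DERIV_chain2[OF pos]]) (use 2 in \<open>auto intro!: derivative_eq_intros\<close>)
    then show ?thesis using 2 by (simp add: psi_pow_uminus phi_pow_def)
  next
    case 3
    have "(psi_pow \<alpha> has_real_derivative 0) (at 0)"
      by (rule has_real_derivative_zero_of_powr_bound[OF _ assms]) (simp add: psi_pow_def abs_mult sgn_if)
    then show ?thesis using 3 by (simp add: phi_pow_def)
  qed (use pos in \<open>auto simp: phi_pow_def\<close>)
qed

text \<open>Differentiation exchanges \<open>phi_pow\<close> and \<open>psi_pow\<close> up to a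
  constant factor and lowers the exponent by one, so inductions on the exponent must treat the two
  together.\<close>

definition entire_powers :: "real \<Rightarrow> (real \<Rightarrow> real) set" where
  "entire_powers \<alpha> = {phi_pow \<alpha>, psi_pow \<alpha>}"

lemma entire_powers_mult: "f \<in> entire_powers \<alpha> \<Longrightarrow> f (x * y) = f x * f y"
  by (auto simp: entire_powers_def phi_pow_mult psi_pow_mult)

lemma entire_powers_nonneg_arg: "f \<in> entire_powers \<alpha> \<Longrightarrow> 0 \<le> x \<Longrightarrow> f x = x powr \<alpha>"
  by (auto simp: entire_powers_def phi_pow_nonneg_arg psi_pow_nonneg_arg)

lemma entire_powers_derivative:
  assumes "f \<in> entire_powers \<alpha>" "1 < \<alpha>"
  obtains g where "g \<in> entire_powers (\<alpha> - 1)"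
    "\<forall>x. (f has_real_derivative \<alpha> * g x) (at x)"
proof -
  from assms consider "f = phi_pow \<alpha>" | "f = psi_pow \<alpha>" by (auto simp: entire_powers_def)
  then show thesis
  proof cases
    case 1
    show thesis
      by (rule that[of "psi_pow (\<alpha> - 1)"])
        (simp_all add: entire_powers_def 1 phi_pow_has_real_derivative assms)
  next
    case 2
    show thesis
      by (rule that[of "phi_pow (\<alpha> - 1)"])
        (simp_all add: entire_powers_def 2 psi_pow_has_real_derivative assms)
  qed
qed

section \<open>Positivity, monotonicity and convexity by differentiation along segments\<close>

lemma qform_entrywise_derivative:
  assumes "\<And>x. (f has_real_derivative \<alpha> * g x) (at x)"
  shows "((\<lambda>t. qform S (\<lambda>i j. f (B i j + t * D i j)) x) has_real_derivative
           \<alpha> * qform S (\<lambda>i j. D i j * g (B i j + t * D i j)) x) (at t)"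
proof -
  have 1: "((\<lambda>t. f (b + t * d)) has_real_derivative \<alpha> * g (b + t * d) * d) (at t)" for b d
    by (rule DERIV_chain2[OF assms]) (auto intro!: derivative_eq_intros)
  have "((\<lambda>t. qform S (\<lambda>i j. f (B i j + t * D i j)) x) has_real_derivative
           (\<Sum>i\<in>S. \<Sum>j\<in>S. x i * x j * (\<alpha> * g (B i j + t * D i j) * D i j))) (at t)"
    unfolding qform_def by (intro DERIV_sum DERIV_cmult 1)
  also have "(\<Sum>i\<in>S. \<Sum>j\<in>S. x i * x j * (\<alpha> * g (B i j + t * D i j) * D i j))
     = \<alpha> * qform S (\<lambda>i j. D i j * g (B i j + t * D i j)) x"
    unfolding qform_def sum_distrib_left by (intro sum.cong refl) (simp only: ac_simps)
  finally show ?thesis .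
qed

text \<open>Along \<open>B + t D\<close> the derivative is the Schur product of \<open>D\<close>
  with an entrywise power of exponent \<open>\<alpha> - 1\<close>, which exceeds
  \<open>card S - 2\<close>. Positivity of such powers is a hypothesis because the lemma is applied
  inside the induction that proves it.\<close>

lemma psd_on_entire_power_mono_aux:
  assumes IH: "\<forall>A g \<beta>. psd_on S A \<longrightarrow> g \<in> entire_powers \<beta> \<longrightarrow> 0 < \<beta> \<longrightarrow> real (card S) - 2 < \<beta> \<longrightarrow>
      psd_on S (\<lambda>i j. g (A i j))"
    and fin: "finite S" and D: "psd_on S D" and B: "psd_on S B"
    and f: "f \<in> entire_powers \<alpha>" and \<alpha>: "0 < \<alpha>" "real (card S) - 1 < \<alpha>"
  shows "psd_on S (\<lambda>i j. f (B i j + D i j) - f (B i j))"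
proof (rule psd_onI)
  fix x
  \<comment> \<open>Only from two indices on does the bound force \<open>1 < \<alpha>\<close>, as
    differentiation requires.\<close>
  consider "S = {}" | i where "S = {i}" | "2 \<le> card S"
  proof -
    have "card S = 0 \<or> card S = 1 \<or> 2 \<le> card S" by linarith
    then show thesis using that fin by (auto simp: card_1_singleton_iff)
  qed
  then show "0 \<le> qform S (\<lambda>i j. f (B i j + D i j) - f (B i j)) x"
  proof cases
    case (2 i)
    then have "0 \<le> B i i" "0 \<le> D i i"
      using psd_on_diag_nonneg[OF B] psd_on_diag_nonneg[OF D] by auto
    then have "0 \<le> f (B i i + D i i) - f (B i i)"
      using \<alpha> by (simp add: entire_powers_nonneg_arg[OF f] powr_mono2)
    then show ?thesis using 2 by (simp add: qform_def)
  next
    case 3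
    then have \<alpha>1: "1 < \<alpha>" using \<alpha> by linarith
    obtain g where g: "g \<in> entire_powers (\<alpha> - 1)"
      and fg: "\<forall>x. (f has_real_derivative \<alpha> * g x) (at x)"
      using entire_powers_derivative[OF f \<alpha>1] by blast
    have "qform S (\<lambda>i j. f (B i j + 0 * D i j)) x \<le> qform S (\<lambda>i j. f (B i j + 1 * D i j)) x"
    proof (rule DERIV_nonneg_imp_nondecreasing[of 0 "1::real"])
      fix t :: real
      assume t: "0 \<le> t" "t \<le> 1"
      have "psd_on S (\<lambda>i j. D i j * g (B i j + t * D i j))"
        by (intro psd_on_schur_product IH[rule_format, OF _ g] psd_on_add psd_on_scale fin D B)
          (use t \<alpha> \<alpha>1 in auto)
      then have "0 \<le> \<alpha> * qform S (\<lambda>i j. D i j * g (B i j + t * D i j)) x"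
        using \<alpha> qform_nonneg by fastforce
      then show "\<exists>y. ((\<lambda>t. qform S (\<lambda>i j. f (B i j + t * D i j)) x) has_real_derivative y) (at t) \<and> 0 \<le> y"
        using qform_entrywise_derivative[OF fg[rule_format]] by blast
    qed simp
    then show ?thesis by (simp add: qform_diff)
  qed (simp add: qform_def)
qed (simp add: psd_on_sym[OF D] psd_on_sym[OF B])

text \<open>FitzGerald and Horn: after subtracting from \<open>A\<close> the rank one matrix that shares its last row and
  column, the last row and column vanish, so that the induction hypothesis controls the derivative
  along the segment between the two matrices.\<close>

lemma psd_on_entire_power:
  assumes "finite S" "psd_on S A" "f \<in> entire_powers \<beta>" "0 < \<beta>" "real (card S) - 2 < \<beta>"
  shows "psd_on S (\<lambda>i j. f (A i j))"
  using assms
proof (induction S arbitrary: A f \<beta> rule: finite_induct)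
  case empty
  then show ?case by (simp add: psd_on_def qform_def)
next
  case (insert k S)
  obtain z where z: "psd_on (insert k S) (\<lambda>i j. A i j - z i * z j)"
    "\<And>i. i \<in> insert k S \<Longrightarrow> A i k = z i * z k" "\<And>i. i \<in> insert k S \<Longrightarrow> A k i = z k * z i"
    using psd_on_schur_complement[OF insert.prems(1), of k] insert.hyps by auto
  have "psd_on S (\<lambda>i j. f (z i * z j + (A i j - z i * z j)) - f (z i * z j))"
  proof (rule psd_on_entire_power_mono_aux)
    show "\<forall>A g \<beta>. psd_on S A \<longrightarrow> g \<in> entire_powers \<beta> \<longrightarrow> 0 < \<beta> \<longrightarrow> real (card S) - 2 < \<beta> \<longrightarrow>
      psd_on S (\<lambda>i j. g (A i j))" using insert.IH by blast
    show "psd_on S (\<lambda>i j. A i j - z i * z j)"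
      using psd_on_subset[OF z(1)] insert.hyps by auto
    \<comment> \<open>Adding \<open>k\<close> raises the cardinality by one: the positivity bound on
      the larger set is the monotonicity bound on \<open>S\<close>.\<close>
    show "real (card S) - 1 < \<beta>" using insert.prems(4) insert.hyps by simp
  qed (use insert psd_on_rank1 in auto)
  then have "psd_on (insert k S) (\<lambda>i j. f (A i j) - f (z i * z j))"
    by (intro psd_on_insert_zero) (use insert.hyps z in auto)
  \<comment> \<open>A multiplicative function maps a rank one kernel to a kernel of the same
    shape.\<close>
  moreover have "psd_on (insert k S) (\<lambda>i j. f (z i * z j))"
    unfolding entire_powers_mult[OF insert.prems(2)] by (rule psd_on_rank1)
  ultimately show ?case using psd_on_add by fastforce
qed

lemma psd_on_entire_power_mono:
  assumes "finite S" "psd_on S D" "psd_on S B" "f \<in> entire_powers \<alpha>" "0 < \<alpha>" "real (card S) - 1 < \<alpha>"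
  shows "psd_on S (\<lambda>i j. f (B i j + D i j) - f (B i j))"
proof (rule psd_on_entire_power_mono_aux)
  show "\<forall>A g \<beta>. psd_on S A \<longrightarrow> g \<in> entire_powers \<beta> \<longrightarrow> 0 < \<beta> \<longrightarrow> real (card S) - 2 < \<beta> \<longrightarrow>
      psd_on S (\<lambda>i j. g (A i j))" using psd_on_entire_power[OF assms(1)] by blast
qed (use assms in auto)

text \<open>Strictness refers to the exponent bound. The exponent \<open>\<alpha> - 1\<close> of
  \<open>g\<close> exceeds \<open>card S - 1\<close>, so \<open>g\<close> is Loewner monotone and
  each quadratic form along the segment has a nondecreasing derivative.\<close>

lemma psd_on_entire_power_convex_strict:
  assumes fin: "finite S" and D: "psd_on S D" and B: "psd_on S B" and f: "f \<in> entire_powers \<alpha>"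
    and \<alpha>: "1 < \<alpha>" "real (card S) < \<alpha>" and t: "0 \<le> t" "t \<le> 1"
  shows "psd_on S (\<lambda>i j. t * f (B i j + D i j) + (1 - t) * f (B i j) - f (B i j + t * D i j))"
proof (rule psd_onI)
  fix x
  obtain g where g: "g \<in> entire_powers (\<alpha> - 1)"
    and fg: "\<forall>x. (f has_real_derivative \<alpha> * g x) (at x)"
    using entire_powers_derivative[OF f \<alpha>(1)] by blast
  let ?h = "\<lambda>t. qform S (\<lambda>i j. f (B i j + t * D i j)) x"
  have "convex_on {0..1} ?h"
  proof (rule convex_on_realI)
    fix r s :: real
    assume rs: "r \<in> {0..1}" "s \<in> {0..1}" "r \<le> s"
    \<comment> \<open>Monotonicity of \<open>g\<close> is applied at the point with parameter
      \<open>r\<close>, with increment \<open>(s - r) * D\<close>.\<close>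
    have "psd_on S (\<lambda>i j. D i j * (g ((B i j + r * D i j) + (s - r) * D i j) - g (B i j + r * D i j)))"
      by (intro psd_on_schur_product psd_on_entire_power_mono[OF _ _ _ g] psd_on_add psd_on_scale fin D B)
        (use \<alpha> rs in auto)
    from qform_nonneg[OF this, of x]
    have "0 \<le> qform S (\<lambda>i j. D i j * g (B i j + s * D i j) - D i j * g (B i j + r * D i j)) x"
      by (simp add: algebra_simps)
    then show "\<alpha> * qform S (\<lambda>i j. D i j * g (B i j + r * D i j)) x
       \<le> \<alpha> * qform S (\<lambda>i j. D i j * g (B i j + s * D i j)) x"
      using \<alpha> by (simp add: qform_diff)
  qed (auto intro!: qform_entrywise_derivative[OF fg[rule_format]])
  from convex_onD[OF this, of t 0 1] t have "?h t \<le> (1 - t) * ?h 0 + t * ?h 1" by simp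
  then show "0 \<le> qform S (\<lambda>i j. t * f (B i j + D i j) + (1 - t) * f (B i j) - f (B i j + t * D i j)) x"
    by (simp add: qform_diff qform_add qform_scale)
qed (simp add: psd_on_sym[OF D] psd_on_sym[OF B])

text \<open>The difference of f[A + t B] and f[t B] grows with \<open>t\<close> because
  \<open>g\<close> is Loewner monotone; it starts at f[A], since \<open>f 0 = 0\<close>, and ends at
  f[A + B] - f[B].\<close>

lemma psd_on_entire_power_superadditive_strict:
  assumes fin: "finite S" and A: "psd_on S A" and B: "psd_on S B" and f: "f \<in> entire_powers \<alpha>"
    and \<alpha>: "1 < \<alpha>" "real (card S) < \<alpha>"
  shows "psd_on S (\<lambda>i j. f (A i j + B i j) - (f (A i j) + f (B i j)))"
proof (rule psd_onI)
  fix x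
  obtain g where g: "g \<in> entire_powers (\<alpha> - 1)"
    and fg: "\<forall>x. (f has_real_derivative \<alpha> * g x) (at x)"
    using entire_powers_derivative[OF f \<alpha>(1)] by blast
  let ?h = "\<lambda>t. qform S (\<lambda>i j. f (A i j + t * B i j)) x - qform S (\<lambda>i j. f (0 + t * B i j)) x"
  have "?h 0 \<le> ?h 1"
  proof (rule DERIV_nonneg_imp_nondecreasing[of 0 "1::real"])
    fix t :: real
    assume t: "0 \<le> t" "t \<le> 1"
    have "psd_on S (\<lambda>i j. B i j * (g (t * B i j + A i j) - g (t * B i j)))"
      by (intro psd_on_schur_product psd_on_entire_power_mono[OF _ _ _ g] psd_on_scale fin A B)
        (use \<alpha> t in auto)
    from qform_nonneg[OF this, of x]
    have "0 \<le> \<alpha> * qform S (\<lambda>i j. B i j * g (A i j + t * B i j)) x - \<alpha> * qform S (\<lambda>i j. B i j * g (0 + t * B i j)) x"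
      using \<alpha> by (simp add: right_diff_distrib qform_diff add.commute)
    then show "\<exists>y. (?h has_real_derivative y) (at t) \<and> 0 \<le> y"
      by (intro exI[of _ "\<alpha> * qform S (\<lambda>i j. B i j * g (A i j + t * B i j)) x
          - \<alpha> * qform S (\<lambda>i j. B i j * g (0 + t * B i j)) x"] conjI
          DERIV_diff qform_entrywise_derivative fg[rule_format])
  qed simp
  moreover have "f 0 = 0" using entire_powers_nonneg_arg[OF f, of 0] by simp
  ultimately show "0 \<le> qform S (\<lambda>i j. f (A i j + B i j) - (f (A i j) + f (B i j))) x"
    by (simp add: qform_diff qform_add) (simp add: qform_def)
qed (simp add: psd_on_sym[OF A] psd_on_sym[OF B])

section \<open>The boundary exponent as a limit\<close>

lemma psd_on_limit:
  assumes F: "F \<noteq> bot" and ev: "\<forall>\<^sub>F a in F. psd_on S (K a)"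
    and lim: "\<And>i j. ((\<lambda>a. K a i j) \<longlongrightarrow> L i j) F"
  shows "psd_on S L"
proof (rule psd_onI)
  fix i j assume ij: "i \<in> S" "j \<in> S"
  have "((\<lambda>a. K a j i) \<longlongrightarrow> L i j) F"
    using ev by (intro Lim_transform_eventually[OF lim[of i j]], eventually_elim)
      (simp add: psd_on_sym[OF _ ij])
  then show "L i j = L j i" using tendsto_unique[OF F] lim by blast
next
  fix x
  have "((\<lambda>a. qform S (K a) x) \<longlongrightarrow> qform S L x) F"
    unfolding qform_def by (intro tendsto_intros lim)
  then show "0 \<le> qform S L x"
    by (rule tendsto_lowerbound[OF _ eventually_mono[OF ev] F]) (rule qform_nonneg)
qed

lemma tendsto_powr_exponent: "((\<lambda>a. x powr a) \<longlongrightarrow> x powr \<alpha>) (at_right \<alpha>)" for x :: real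
  by (cases "x = 0") (auto intro!: tendsto_intros)

text \<open>Keeps the parity type of \<open>f\<close> while the exponent decreases to \<alpha>,
  where the strict bounds are available.\<close>

lemma entire_powers_continuous_exponent:
  assumes "f \<in> entire_powers \<alpha>"
  obtains F where "\<And>a. F a \<in> entire_powers a"
    "\<And>x. ((\<lambda>a. F a x) \<longlongrightarrow> f x) (at_right \<alpha>)"
proof -
  have phi: "((\<lambda>a. phi_pow a x) \<longlongrightarrow> phi_pow \<alpha> x) (at_right \<alpha>)" for x
    unfolding phi_pow_def by (rule tendsto_powr_exponent)
  have psi: "((\<lambda>a. psi_pow a x) \<longlongrightarrow> psi_pow \<alpha> x) (at_right \<alpha>)" for x
    unfolding psi_pow_def by (intro tendsto_intros tendsto_powr_exponent)
  from assms consider "f = phi_pow \<alpha>" | "f = psi_pow \<alpha>" by (auto simp: entire_powers_def)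
  then show thesis
  proof cases
    case 1
    show thesis by (rule that[of phi_pow]) (use phi 1 in \<open>auto simp: entire_powers_def\<close>)
  next
    case 2
    show thesis by (rule that[of psi_pow]) (use psi 2 in \<open>auto simp: entire_powers_def\<close>)
  qed
qed

lemma psd_on_entire_power_convex:
  assumes fin: "finite S" and D: "psd_on S D" and B: "psd_on S B" and f: "f \<in> entire_powers \<alpha>"
    and \<alpha>: "1 \<le> \<alpha>" "real (card S) \<le> \<alpha>" and t: "0 \<le> t" "t \<le> 1"
  shows "psd_on S (\<lambda>i j. t * f (B i j + D i j) + (1 - t) * f (B i j) - f (B i j + t * D i j))"
proof -
  obtain F where F: "\<And>a. F a \<in> entire_powers a" "\<And>x. ((\<lambda>a. F a x) \<longlongrightarrow> f x) (at_right \<alpha>)"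
    using entire_powers_continuous_exponent[OF f] by metis
  show ?thesis
  proof (rule psd_on_limit)
    show "\<forall>\<^sub>F a in at_right \<alpha>. psd_on S (\<lambda>i j. t * F a (B i j + D i j) + (1 - t) * F a (B i j)
        - F a (B i j + t * D i j))"
      using eventually_at_right_less[of \<alpha>]
      by eventually_elim (rule psd_on_entire_power_convex_strict[OF fin D B F(1)], use \<alpha> t in auto)
  qed (auto intro!: tendsto_intros F(2))
qed

lemma psd_on_entire_power_superadditive:
  assumes fin: "finite S" and A: "psd_on S A" and B: "psd_on S B" and f: "f \<in> entire_powers \<alpha>"
    and \<alpha>: "1 \<le> \<alpha>" "real (card S) \<le> \<alpha>"
  shows "psd_on S (\<lambda>i j. f (A i j + B i j) - (f (A i j) + f (B i j)))"
proof -
  obtain F where F: "\<And>a. F a \<in> entire_powers a" "\<And>x. ((\<lambda>a. F a x) \<longlongrightarrow> f x) (at_right \<alpha>)"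
    using entire_powers_continuous_exponent[OF f] by metis
  show ?thesis
  proof (rule psd_on_limit)
    show "\<forall>\<^sub>F a in at_right \<alpha>. psd_on S (\<lambda>i j. F a (A i j + B i j) - (F a (A i j) + F a (B i j)))"
      using eventually_at_right_less[of \<alpha>]
      by eventually_elim (rule psd_on_entire_power_superadditive_strict[OF fin A B F(1)], use \<alpha> in auto)
  qed (auto intro!: tendsto_intros F(2))
qed

section \<open>Powers below the critical exponent\<close>

definition divided_difference_weight :: "real set \<Rightarrow> real \<Rightarrow> real" where
  "divided_difference_weight X x = 1 / (\<Prod>z\<in>X - {x}. x - z)"

text \<open>The top coefficient of the Lagrange interpolant is the divided difference of
  \<open>g\<close>. Vanishing coefficients, in place of a degree bound, also cover empty
  \<open>X\<close>, where \<open>q = 0\<close>; this case arises for \<alpha> < 1.\<close>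

lemma lagrange_interpolation:
  fixes X :: "real set" and g :: "real \<Rightarrow> real"
  assumes fin: "finite X"
  shows "\<exists>q. (\<forall>x\<in>X. poly q x = g x) \<and> (\<forall>k\<ge>card X. coeff q k = 0) \<and>
    coeff q (card X - 1) = (\<Sum>x\<in>X. divided_difference_weight X x * g x)"
proof -
  define L where "L y = (\<Prod>z\<in>X - {y}. [:- z, 1:])" for y :: real
  define q where "q = (\<Sum>y\<in>X. smult (divided_difference_weight X y * g y) (L y))"
  have deg: "degree (L y) = card X - 1" and lead: "coeff (L y) (card X - 1) = 1" if "y \<in> X" for y
  proof -
    show d: "degree (L y) = card X - 1"
      unfolding L_def using that fin by (subst degree_prod_eq_sum_degree) auto
    have "lead_coeff (L y) = 1" unfolding L_def by (simp add: lead_coeff_prod)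
    then show "coeff (L y) (card X - 1) = 1" by (simp add: d)
  qed
  have Lx: "poly (L y) x = 0" if "x \<in> X" "x \<noteq> y" for x y
    using that fin by (auto simp: L_def poly_prod intro!: prod_zero)
  have Lxx: "poly (L x) x = (\<Prod>z\<in>X - {x}. x - z)" for x
    by (simp add: L_def poly_prod)
  have "poly q x = g x" if x: "x \<in> X" for x
  proof -
    have "poly q x = (\<Sum>y\<in>X. if y = x then divided_difference_weight X x * g x * poly (L x) x else 0)"
      unfolding q_def poly_sum using Lx[OF x] by (intro sum.cong) auto
    also have "\<dots> = divided_difference_weight X x * g x * poly (L x) x" using fin x by simp
    also have "\<dots> = g x" using fin by (simp add: Lxx divided_difference_weight_def)
    finally show ?thesis .
  qed
  moreover have "coeff q k = 0" if "card X \<le> k" for k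
  proof -
    have "coeff (L y) k = 0" if "y \<in> X" for y
    proof (rule coeff_eq_0)
      have "card X > 0" using fin that by (auto simp: card_gt_0_iff)
      then show "degree (L y) < k" using deg[OF that] \<open>card X \<le> k\<close> by simp
    qed
    then show ?thesis by (simp add: q_def coeff_sum)
  qed
  moreover have "coeff q (card X - 1) = (\<Sum>x\<in>X. divided_difference_weight X x * g x)"
    unfolding q_def coeff_sum using lead by (intro sum.cong) auto
  ultimately show ?thesis by (intro exI[of _ q]) simp
qed

text \<open>Uniqueness of interpolation: a nonzero difference from the interpolant would have
  \<open>card X\<close> roots but smaller degree.\<close>

lemma divided_difference_poly:
  assumes fin: "finite X" and p: "\<And>k. card X \<le> k \<Longrightarrow> coeff p k = 0"
  shows "(\<Sum>x\<in>X. divided_difference_weight X x * poly p x) = coeff p (card X - 1)"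
proof -
  obtain q where q: "\<forall>x\<in>X. poly q x = poly p x" "\<forall>k\<ge>card X. coeff q k = 0"
    "coeff q (card X - 1) = (\<Sum>x\<in>X. divided_difference_weight X x * poly p x)"
    using lagrange_interpolation[OF fin, of "poly p"] by blast
  have "p - q = 0"
  proof (rule ccontr)
    assume nz: "p - q \<noteq> 0"
    have "card X \<le> card {x. poly (p - q) x = 0}"
      using q(1) by (intro card_mono poly_roots_finite[OF nz]) auto
    also have "\<dots> \<le> degree (p - q)" by (rule card_poly_roots_bound[OF nz])
    finally have "coeff (p - q) (degree (p - q)) = 0" using p q(2) by simp
    then show False using nz leading_coeff_0_iff by blast
  qed
  then show ?thesis using q(3) by simp
qed

lemma divided_difference_power:
  assumes "finite X" "card X = Suc m" "k \<le> m"
  shows "(\<Sum>x\<in>X. divided_difference_weight X x * x ^ k) = (if k = m then 1 else 0)"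
  using divided_difference_poly[OF assms(1), of "monom 1 k"] assms(2,3) by (simp add: poly_monom)

section \<open>Asymptotics of binomial kernels\<close>

lemma binomial_kernel_expansion:
  fixes X :: "real set" and \<alpha> :: real and w :: "real \<Rightarrow> real"
  assumes fin: "finite X"
  defines "a \<equiv> \<lambda>k. (\<alpha> gchoose k) * (\<Sum>x\<in>X. w x * x ^ k)\<^sup>2"
  shows "((\<lambda>e. (qform X (\<lambda>x y. (1 + e * (x * y)) powr \<alpha>) w - (\<Sum>k<m. a k * e ^ k)) / e ^ m)
           \<longlongrightarrow> a m) (at 0)"
proof -
  \<comment> \<open>A common bound for all products of two nodes; each binomial series converges
    when \<open>\<bar>e\<bar> < 1 / (1 + M)\<close>.\<close>
  define M where "M = (\<Sum>x\<in>X. x\<^sup>2)"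
  have M0: "0 \<le> M" by (simp add: M_def sum_nonneg)
  have M: "\<bar>x * y\<bar> \<le> M" if "x \<in> X" "y \<in> X" for x y
  proof -
    have "x\<^sup>2 \<le> M" "y\<^sup>2 \<le> M" unfolding M_def using fin that by (auto intro!: member_le_sum)
    moreover have "2 * \<bar>x * y\<bar> \<le> x\<^sup>2 + y\<^sup>2" using sum_squares_bound[of "\<bar>x\<bar>" "\<bar>y\<bar>"] by (simp add: abs_mult)
    ultimately show ?thesis by linarith
  qed
  have sums: "(\<lambda>k. a k * e ^ k) sums qform X (\<lambda>x y. (1 + e * (x * y)) powr \<alpha>) w"
    if e: "norm e < 1 / (1 + M)" for e :: real
  proof -
    have small: "\<bar>e * (x * y)\<bar> < 1" if "x \<in> X" "y \<in> X" for x y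
    proof -
      have "\<bar>e * (x * y)\<bar> \<le> \<bar>e\<bar> * (1 + M)"
        unfolding abs_mult[of e] using M[OF that] by (intro mult_left_mono) auto
      also have "\<dots> < 1" using e M0 by (simp add: field_simps)
      finally show ?thesis .
    qed
    \<comment> \<open>Each term of the series is a multiple of a rank one kernel, so its form is a
      squared moment of \<open>w\<close>.\<close>
    have "(\<lambda>k. \<Sum>x\<in>X. \<Sum>y\<in>X. w x * w y * ((\<alpha> gchoose k) * (e * (x * y)) ^ k))
       sums qform X (\<lambda>x y. (1 + e * (x * y)) powr \<alpha>) w"
      unfolding qform_def by (intro sums_sum sums_mult gen_binomial_real small)
    also have "(\<lambda>k. \<Sum>x\<in>X. \<Sum>y\<in>X. w x * w y * ((\<alpha> gchoose k) * (e * (x * y)) ^ k)) = (\<lambda>k. a k * e ^ k)"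
      unfolding a_def power2_eq_square sum_product sum_distrib_left sum_distrib_right
      by (intro ext sum.cong refl) (simp add: power_mult_distrib)
    finally show ?thesis .
  qed
  \<comment> \<open>Dropping \<open>m\<close> terms and dividing by \<open>e ^ m\<close> leaves a
    power series with constant term \<open>a m\<close>, its limit at 0.\<close>
  have "((\<lambda>e. (qform X (\<lambda>x y. (1 + e * (x * y)) powr \<alpha>) w - (\<Sum>k<m. a k * e ^ k)) / e ^ m)
           \<longlongrightarrow> a (0 + m)) (at 0)"
  proof (rule powser_limit_0_strong)
    show "0 < 1 / (1 + M)" using M0 by simp
    fix e :: real
    assume e: "e \<noteq> 0" "norm e < 1 / (1 + M)"
    have "(\<lambda>k. a (k + m) * e ^ (k + m) / e ^ m) sums
       ((qform X (\<lambda>x y. (1 + e * (x * y)) powr \<alpha>) w - (\<Sum>k<m. a k * e ^ k)) / e ^ m)"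
      by (intro sums_divide sums_split_initial_segment sums e)
    then show "(\<lambda>k. a (k + m) * e ^ k) sums
       ((qform X (\<lambda>x y. (1 + e * (x * y)) powr \<alpha>) w - (\<Sum>k<m. a k * e ^ k)) / e ^ m)"
      using e by (simp add: power_add)
  qed
  then show ?thesis by simp
qed

text \<open>For small \<open>e\<close> the arguments stay positive even at nodes of opposite sign,
  so that \<open>f\<close> is given by \<open>powr\<close> there.\<close>

lemma eventually_kernel_pos:
  fixes X :: "real set"
  assumes fin: "finite X" and c: "0 < c"
  shows "\<forall>\<^sub>F e in at_right 0. 0 < e \<and> (\<forall>x\<in>X. \<forall>y\<in>X. 0 < c + e * (x * y))"
proof -
  have "\<forall>\<^sub>F e in at_right 0. 0 < c + e * (x * y)" for x y :: real
    by (rule order_tendstoD(1)[of _ c]) (use c in \<open>auto intro!: tendsto_eq_intros\<close>)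
  then show ?thesis
    using fin by (auto intro!: eventually_conj eventually_ball_finite simp: eventually_at_right_less)
qed

lemma powr_over_power_tendsto_0:
  assumes "real m < \<alpha>"
  shows "((\<lambda>e::real. e powr \<alpha> / e ^ m) \<longlongrightarrow> 0) (at_right 0)"
proof (rule Lim_transform_eventually)
  show "((\<lambda>e::real. e powr (\<alpha> - real m)) \<longlongrightarrow> 0) (at_right 0)"
    by (rule tendsto_zero_powrI[where b = "\<alpha> - m"])
      (use assms in \<open>auto intro!: tendsto_eq_intros simp: eventually_at_right_less eventually_at_filter\<close>)
  show "\<forall>\<^sub>F e::real in at_right 0. e powr (\<alpha> - real m) = e powr \<alpha> / e ^ m"
    by (auto simp: eventually_at_filter powr_diff powr_realpow)
qed

lemma power_over_powr_tendsto_0: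
  assumes "\<alpha> < real m"
  shows "((\<lambda>e::real. e ^ m / e powr \<alpha>) \<longlongrightarrow> 0) (at_right 0)"
proof (rule Lim_transform_eventually)
  show "((\<lambda>e::real. e powr (real m - \<alpha>)) \<longlongrightarrow> 0) (at_right 0)"
    by (rule tendsto_zero_powrI[where b = "m - \<alpha>"])
      (use assms in \<open>auto intro!: tendsto_eq_intros simp: eventually_at_right_less eventually_at_filter\<close>)
  show "\<forall>\<^sub>F e::real in at_right 0. e powr (real m - \<alpha>) = e ^ m / e powr \<alpha>"
    by (auto simp: eventually_at_filter powr_diff powr_realpow)
qed

text \<open>What the three functions share on their domains. Values at negative arguments are
  constrained only through multiplicativity, which leaves both parities possible.\<close>

locale power_function =
  fixes I :: "real set" and f :: "real \<Rightarrow> real" and \<alpha> :: real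
  assumes domain: "I = {0..} \<or> I = UNIV"
    and nonneg_arg: "0 \<le> x \<Longrightarrow> f x = x powr \<alpha>"
    and mult: "x \<in> I \<Longrightarrow> y \<in> I \<Longrightarrow> f (x * y) = f x * f y"
    and exponent_pos: "0 < \<alpha>"
begin

lemma nonneg_in_domain: "0 \<le> x \<Longrightarrow> x \<in> I"
  using domain by auto

lemma mult_in_domain: "x \<in> I \<Longrightarrow> y \<in> I \<Longrightarrow> x * y \<in> I"
  using domain by auto

lemma add_in_domain: "x \<in> I \<Longrightarrow> y \<in> I \<Longrightarrow> x + y \<in> I"
  using domain by auto

lemma kernel_scaled:
  assumes "0 \<le> e" "x \<in> I" "y \<in> I"
  shows "f (e * (x * y)) = e powr \<alpha> * (f x * f y)"
  using assms by (simp add: mult nonneg_in_domain mult_in_domain nonneg_arg)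

text \<open>The midpoint inequality is divided by \<open>e ^ m\<close> and \<open>e\<close> tends to
  0. The first and third kernels contribute through their binomial coefficient of order
  \<open>m\<close>, the second through \<open>l\<close>, which is 0 for \<open>m < \<alpha>\<close>
  and 1 for \<open>m = \<alpha>\<close>.\<close>

lemma convex_kernel_leading_coefficient:
  assumes fin: "finite X" and X: "X \<subseteq> I"
    and conv: "\<And>e. 0 < e \<Longrightarrow>
       0 \<le> qform X (\<lambda>x y. 1/2 * f (1 + e * (x * y)) + 1/2 * f (e * (x * y)) - f (1/2 + e * (x * y))) w"
    and mom: "\<And>k. k < m \<Longrightarrow> (\<Sum>x\<in>X. w x * x ^ k) = 0" "(\<Sum>x\<in>X. w x * x ^ m) = 1"
    and lim: "((\<lambda>e. e powr \<alpha> / e ^ m) \<longlongrightarrow> l) (at_right 0)"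
  shows "0 \<le> (\<alpha> gchoose m) * (1/2 - 2 powr (m - \<alpha>)) + l * (\<Sum>x\<in>X. w x * f x)\<^sup>2 / 2"
proof -
  let ?N = "\<Sum>x\<in>X. w x * f x" and ?c = "\<alpha> gchoose m"
  let ?F = "\<lambda>e. qform X (\<lambda>x y. (1 + e * (x * y)) powr \<alpha>) w"
  have F: "((\<lambda>e. ?F e / e ^ m) \<longlongrightarrow> ?c) (at_right 0)"
    using tendsto_within_subset[OF binomial_kernel_expansion[OF fin, where m = m and w = w and \<alpha> = \<alpha>],
        of "{0<..}"] mom by simp
  \<comment> \<open>Factoring 1/2 out of \<open>1/2 + e * (x * y)\<close> leaves the binomial kernel
    at \<open>2 * e\<close>.\<close>
  have scale: "filterlim (\<lambda>e. 2 * e :: real) (at_right 0) (at_right 0)"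
    by (auto simp: filterlim_at eventually_at_filter intro!: tendsto_eq_intros)
  have "((\<lambda>e. ?F (2 * e) / (2 * e) ^ m * 2 ^ m) \<longlongrightarrow> ?c * 2 ^ m) (at_right 0)"
    by (intro tendsto_mult tendsto_const filterlim_compose[OF F scale])
  then have F2: "((\<lambda>e. ?F (2 * e) / e ^ m) \<longlongrightarrow> ?c * 2 ^ m) (at_right 0)"
    by (simp add: power_mult_distrib)
  have "((\<lambda>e. 1/2 * (?F e / e ^ m) + (e powr \<alpha> / e ^ m) * ?N\<^sup>2 / 2 - (1/2) powr \<alpha> * (?F (2 * e) / e ^ m))
      \<longlongrightarrow> 1/2 * ?c + l * ?N\<^sup>2 / 2 - (1/2) powr \<alpha> * (?c * 2 ^ m)) (at_right 0)"
    by (intro tendsto_intros F F2 lim) auto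
  then have "0 \<le> 1/2 * ?c + l * ?N\<^sup>2 / 2 - (1/2) powr \<alpha> * (?c * 2 ^ m)"
  proof (rule tendsto_lowerbound)
    show "\<forall>\<^sub>F e in at_right 0. 0 \<le> 1/2 * (?F e / e ^ m) + (e powr \<alpha> / e ^ m) * ?N\<^sup>2 / 2
        - (1/2) powr \<alpha> * (?F (2 * e) / e ^ m)"
      using eventually_kernel_pos[OF fin, of "1/2", simplified]
    proof eventually_elim
      case (elim e)
      have "0 \<le> qform X (\<lambda>x y. 1/2 * f (1 + e * (x * y)) + 1/2 * f (e * (x * y)) - f (1/2 + e * (x * y))) w"
        using conv elim by blast
      also have "\<dots> = qform X (\<lambda>x y. 1/2 * (1 + e * (x * y)) powr \<alpha> + e powr \<alpha> / 2 * (f x * f y)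
           - (1/2) powr \<alpha> * (1 + (2 * e) * (x * y)) powr \<alpha>) w"
      proof (rule qform_cong)
        fix x y assume xy: "x \<in> X" "y \<in> X"
        then have pos: "0 < 1/2 + e * (x * y)" using elim by simp
        have "(1/2 + e * (x * y)) powr \<alpha> = (1/2 * (1 + (2 * e) * (x * y))) powr \<alpha>" by (simp add: algebra_simps)
        also have "\<dots> = (1/2) powr \<alpha> * (1 + (2 * e) * (x * y)) powr \<alpha>"
          by (rule powr_mult)
        finally have "f (1/2 + e * (x * y)) = (1/2) powr \<alpha> * (1 + (2 * e) * (x * y)) powr \<alpha>"
          using pos by (simp add: nonneg_arg)
        moreover have "f (1 + e * (x * y)) = (1 + e * (x * y)) powr \<alpha>"
          by (rule nonneg_arg) (use pos in simp)
        moreover have "f (e * (x * y)) = e powr \<alpha> * (f x * f y)"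
          by (rule kernel_scaled) (use elim xy X in auto)
        ultimately show "1/2 * f (1 + e * (x * y)) + 1/2 * f (e * (x * y)) - f (1/2 + e * (x * y)) =
          1/2 * (1 + e * (x * y)) powr \<alpha> + e powr \<alpha> / 2 * (f x * f y)
           - (1/2) powr \<alpha> * (1 + (2 * e) * (x * y)) powr \<alpha>" by simp
      qed
      also have "\<dots> = 1/2 * ?F e + e powr \<alpha> / 2 * ?N\<^sup>2 - (1/2) powr \<alpha> * ?F (2 * e)"
        by (simp only: qform_add qform_diff qform_scale qform_rank1)
      finally have "0 \<le> (1/2 * ?F e + e powr \<alpha> / 2 * ?N\<^sup>2 - (1/2) powr \<alpha> * ?F (2 * e)) / e ^ m"
        using elim by (intro divide_nonneg_nonneg) auto
      then show ?case by (simp add: diff_divide_distrib add_divide_distrib)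
    qed
  qed simp
  also have "(1/2) powr \<alpha> * (?c * 2 ^ m) = ?c * 2 powr (m - \<alpha>)"
    by (simp add: powr_diff powr_realpow powr_divide)
  finally show ?thesis by (simp add: algebra_simps)
qed

text \<open>Division by \<open>e powr \<alpha>\<close>: the order zero term cancels against
  \<open>f 1\<close>, orders 1 to \<open>m\<close> vanish by the moments, and the remainder of order
  \<open>m + 1\<close> is negligible. Minus the square of the moment of \<open>f\<close> is thus
  nonnegative.\<close>

lemma superadditive_kernel_moment:
  assumes fin: "finite X" and X: "X \<subseteq> I"
    and super: "\<And>e. 0 < e \<Longrightarrow> 0 \<le> qform X (\<lambda>x y. f (1 + e * (x * y)) - (f 1 + f (e * (x * y)))) w"
    and mom: "\<And>k. 1 \<le> k \<Longrightarrow> k \<le> m \<Longrightarrow> (\<Sum>x\<in>X. w x * x ^ k) = 0"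
    and m: "\<alpha> < Suc m"
  shows "(\<Sum>x\<in>X. w x * f x) = 0"
proof -
  let ?N = "\<Sum>x\<in>X. w x * f x"
  let ?F = "\<lambda>e. qform X (\<lambda>x y. (1 + e * (x * y)) powr \<alpha>) w"
  let ?a = "\<lambda>k. (\<alpha> gchoose k) * (\<Sum>x\<in>X. w x * x ^ k)\<^sup>2"
  have a: "(\<Sum>k<Suc m. ?a k * e ^ k) = (\<Sum>x\<in>X. w x)\<^sup>2" for e
    by (subst sum.lessThan_Suc_shift) (simp add: mom[of "Suc _"] del: power_Suc)
  have "((\<lambda>e. (?F e - (\<Sum>x\<in>X. w x)\<^sup>2) / e ^ Suc m) \<longlongrightarrow> ?a (Suc m)) (at_right 0)"
    using binomial_kernel_expansion[OF fin, where m = "Suc m" and w = w and \<alpha> = \<alpha>] unfolding a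
    by (rule tendsto_within_subset) auto
  then have "((\<lambda>e. (?F e - (\<Sum>x\<in>X. w x)\<^sup>2) / e ^ Suc m * (e ^ Suc m / e powr \<alpha>) - ?N\<^sup>2)
      \<longlongrightarrow> ?a (Suc m) * 0 - ?N\<^sup>2) (at_right 0)"
    by (intro tendsto_diff tendsto_mult tendsto_const power_over_powr_tendsto_0 m)
  then have "0 \<le> ?a (Suc m) * 0 - ?N\<^sup>2"
  proof (rule tendsto_lowerbound)
    show "\<forall>\<^sub>F e in at_right 0. 0 \<le> (?F e - (\<Sum>x\<in>X. w x)\<^sup>2) / e ^ Suc m * (e ^ Suc m / e powr \<alpha>) - ?N\<^sup>2"
      using eventually_kernel_pos[OF fin, of 1, simplified]
    proof eventually_elim
      case (elim e)
      have "0 \<le> qform X (\<lambda>x y. f (1 + e * (x * y)) - (f 1 + f (e * (x * y)))) w"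
        using super elim by blast
      also have "\<dots> = qform X (\<lambda>x y. (1 + e * (x * y)) powr \<alpha> - (1 * 1 + e powr \<alpha> * (f x * f y))) w"
        using elim X by (intro qform_cong) (auto simp: nonneg_arg kernel_scaled less_imp_le subset_iff)
      also have "\<dots> = ?F e - ((\<Sum>x\<in>X. w x)\<^sup>2 + e powr \<alpha> * ?N\<^sup>2)"
        using qform_rank1[of X "\<lambda>_. 1" w] by (simp add: qform_add qform_diff qform_scale qform_rank1)
      finally have "0 \<le> (?F e - ((\<Sum>x\<in>X. w x)\<^sup>2 + e powr \<alpha> * ?N\<^sup>2)) / e powr \<alpha>"
        using elim by (intro divide_nonneg_nonneg) auto
      moreover have "u / e ^ Suc m * (e ^ Suc m / e powr \<alpha>) - ?N\<^sup>2 = (u - e powr \<alpha> * ?N\<^sup>2) / e powr \<alpha>" for u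
        using elim by (simp add: diff_divide_distrib)
      ultimately show ?case by (simp only: diff_diff_eq)
    qed
  qed simp
  then show ?thesis by simp
qed

end

section \<open>Recognising monomials\<close>

lemma poly_eq_if_eq_on_half_line:
  fixes p q :: "real poly"
  assumes "\<And>x. 0 \<le> x \<Longrightarrow> poly p x = poly q x"
  shows "p = q"
proof (rule ccontr)
  assume "p \<noteq> q"
  then have "finite {x. poly (p - q) x = 0}" by (intro poly_roots_finite) simp
  moreover have "{0..} \<subseteq> {x. poly (p - q) x = 0}" using assms by auto
  ultimately have "finite {0::real..}" by (rule finite_subset[rotated])
  then show False using infinite_Ici by blast
qed

lemma gbinomial_pos_real:
  fixes a :: real
  assumes "real m \<le> a"
  shows "0 < a gchoose m"
  unfolding gbinomial_prod_rev using assms by (intro divide_pos_pos prod_pos) auto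

context power_function
begin

text \<open>Comparing the leading coefficients in \<open>f (2 * x) = 2 powr \<alpha> * f x\<close> determines the degree.\<close>

lemma polynomial_imp_monomial:
  assumes p: "\<And>x. x \<in> I \<Longrightarrow> f x = poly p x"
  shows "\<exists>m. \<alpha> = real m \<and> (\<forall>x\<in>I. f x = x ^ m)"
proof -
  have "pcompose p [:0, 2:] = smult (2 powr \<alpha>) p"
  proof (rule poly_eq_if_eq_on_half_line)
    fix x :: real assume x: "0 \<le> x"
    have "poly p (2 * x) = f (2 * x)" "f x = poly p x" using p x nonneg_in_domain by auto
    then show "poly (pcompose p [:0, 2:]) x = poly (smult (2 powr \<alpha>) p) x"
      using x by (simp add: poly_pcompose nonneg_arg powr_mult mult.commute)
  qed
  then have "coeff (pcompose p [:0, 2:]) (degree p) = 2 powr \<alpha> * lead_coeff p" by simp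
  moreover have "p \<noteq> 0" using p[of 1] nonneg_in_domain[of 1] nonneg_arg[of 1] by auto
  ultimately have "2 powr real (degree p) = 2 powr \<alpha>"
    by (simp add: coeff_pcompose_linear powr_realpow)
  then have \<alpha>: "\<alpha> = real (degree p)" using powr_inj[of "2::real" "real (degree p)" \<alpha>] by simp
  \<comment> \<open>Matters at \<open>x = 0\<close>, where \<open>0 powr \<alpha>\<close> is 0 but
    \<open>0 ^ 0\<close> is 1.\<close>
  then have "degree p > 0" using exponent_pos by simp
  have "p = monom 1 (degree p)"
  proof (rule poly_eq_if_eq_on_half_line)
    fix x :: real assume x: "0 \<le> x"
    have "poly p x = x powr \<alpha>" using p x nonneg_in_domain nonneg_arg by metis
    also have "\<dots> = x ^ degree p"
      unfolding \<alpha> using x \<open>degree p > 0\<close> by (cases "x = 0") (auto simp: powr_realpow)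
    finally show "poly p x = poly (monom 1 (degree p)) x" by (simp add: poly_monom)
  qed
  then have "poly p x = x ^ degree p" for x by (metis poly_monom mult_1)
  then show ?thesis using p \<alpha> by auto
qed

text \<open>For non-integer \<alpha> the leading coefficient is negative at any \<open>m + 1\<close>
  nodes. For \<open>\<alpha> = m\<close> only the wrong parity is left, and the node -1 detects
  it.\<close>

lemma convex_kernel_imp_monomial:
  assumes conv: "\<And>X e w. finite X \<Longrightarrow> X \<subseteq> I \<Longrightarrow> X \<noteq> {} \<Longrightarrow> card X \<le> n \<Longrightarrow> 0 < e \<Longrightarrow>
       0 \<le> qform X (\<lambda>x y. 1/2 * f (1 + e * (x * y)) + 1/2 * f (e * (x * y)) - f (1/2 + e * (x * y))) w"
    and small: "\<alpha> < real n"
  shows "\<exists>m. \<alpha> = real m \<and> (\<forall>x\<in>I. f x = x ^ m)"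
proof (rule ccontr)
  assume neg: "\<not> ?thesis"
  define m where "m = nat \<lfloor>\<alpha>\<rfloor>"
  have m: "real m \<le> \<alpha>" "\<alpha> < real m + 1" using exponent_pos unfolding m_def by linarith+
  have mn: "Suc m \<le> n" using m small by linarith
  have main: "0 \<le> (\<alpha> gchoose m) * (1/2 - 2 powr (m - \<alpha>))
      + l * (\<Sum>x\<in>X. divided_difference_weight X x * f x)\<^sup>2 / 2"
    if X: "finite X" "X \<subseteq> I" "card X = Suc m" and l: "((\<lambda>e. e powr \<alpha> / e ^ m) \<longlongrightarrow> l) (at_right 0)" for X l
  proof (rule convex_kernel_leading_coefficient[OF X(1,2) conv[OF X(1,2)] _ _ l])
    show "X \<noteq> {}" "card X \<le> n" using X(3) mn by auto
  qed (use divided_difference_power[OF X(1,3)] in auto)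
  show False
  proof (cases "real m < \<alpha>")
    case True
    have "card (real ` {0..m}) = Suc m" by (simp add: card_image)
    then have "0 \<le> (\<alpha> gchoose m) * (1/2 - 2 powr (m - \<alpha>))"
      using main[OF _ _ _ powr_over_power_tendsto_0[OF True], of "real ` {0..m}"] nonneg_in_domain
      by (simp add: image_subset_iff)
    \<comment> \<open>\<open>m - \<alpha> > -1\<close> makes the factor
      \<open>1/2 - 2 powr (m - \<alpha>)\<close> negative.\<close>
    moreover have "2 powr (-1) < (2::real) powr (m - \<alpha>)"
      by (rule powr_less_mono) (use m in auto)
    ultimately show False
      using gbinomial_pos_real[OF m(1)] by (simp add: zero_le_mult_iff powr_minus)
  next
    case False
    then have \<alpha>: "\<alpha> = real m" using m by simp
    then have m0: "0 < m" using exponent_pos by simp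
    have powm: "f x = x ^ m" if "0 \<le> x" for x
      using that m0 by (cases "x = 0") (auto simp: nonneg_arg \<alpha> powr_realpow)
    obtain x0 where x0: "x0 \<in> I" "f x0 \<noteq> x0 ^ m" using neg \<alpha> by blast
    then have x0neg: "x0 < 0" using powm[of x0] by (cases "x0 < 0") auto
    then have I: "I = UNIV" using domain x0 by auto
    \<comment> \<open>Multiplicativity moves the disagreement with the monomial to -1, where the
      only possible values are 1 and -1.\<close>
    have "f x0 = f (-1) * (- x0) ^ m"
      using mult[of "-1" "- x0"] I powm[of "- x0"] x0neg by simp
    then have ne: "f (-1) \<noteq> (-1) ^ m"
      using x0(2) power_mult_distrib[of "-1" "- x0" m] by auto
    have "f (-1) * f (-1) = 1" using mult[of "-1" "-1"] I powm[of 1] by simp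
    then have "f (-1) = 1 \<or> f (-1) = -1" by (simp add: square_eq_1_iff)
    then have fneg: "f (-1) = - ((-1) ^ m)" using ne by (cases "even m") auto
    \<comment> \<open>With the nodes -1, 1, ..., m, the function differs from the monomial at a
      single node, and there only in sign.\<close>
    define Y where "Y = real ` {1..m}"
    define X where "X = insert (-1) Y"
    have Y: "finite Y" "-1 \<notin> Y" "card Y = m" "\<And>y. y \<in> Y \<Longrightarrow> 1 \<le> y"
      by (auto simp: Y_def card_image)
    have X: "finite X" "card X = Suc m" using Y by (auto simp: X_def)
    let ?w = "divided_difference_weight X"
    define P where "P = (\<Prod>y\<in>Y. 1 + y)"
    have "1 < P"
    proof -
      have "2 ^ m = (\<Prod>y\<in>Y. 2 :: real)" using Y by simp
      also have "\<dots> \<le> P" unfolding P_def by (rule prod_mono) (use Y in auto)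
      finally have "2 ^ m \<le> P" .
      moreover have "1 < (2::real) ^ m" by (rule one_less_power) (use m0 in auto)
      ultimately show ?thesis by linarith
    qed
    have "?w (-1) * (-1) ^ m = 1 / P"
    proof -
      have "X - {-1} = Y" using Y by (auto simp: X_def)
      moreover have "(\<Prod>y\<in>Y. - 1 - y) = (\<Prod>y\<in>Y. (-1) * (1 + y))" by (intro prod.cong) auto
      then have "(\<Prod>y\<in>Y. - 1 - y) = (-1) ^ m * P"
        unfolding prod.distrib by (simp add: Y P_def)
      ultimately show ?thesis by (simp add: divided_difference_weight_def)
    qed
    moreover have "(\<Sum>x\<in>X. ?w x * f x) = (\<Sum>x\<in>X. ?w x * x ^ m) - 2 * (?w (-1) * (-1) ^ m)"
    proof -
      have "(\<Sum>x\<in>Y. ?w x * f x) = (\<Sum>x\<in>Y. ?w x * x ^ m)"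
        using Y by (intro sum.cong refl) (simp add: powm order_trans[OF zero_le_one])
      then show ?thesis using Y fneg by (simp add: X_def)
    qed
    ultimately have N: "(\<Sum>x\<in>X. ?w x * f x) = 1 - 2 * (1 / P)"
      using divided_difference_power[OF X, of m] by simp
    have "((\<lambda>e. e powr \<alpha> / e ^ m) \<longlongrightarrow> 1) (at_right 0)"
      by (rule Lim_transform_eventually[OF tendsto_const])
        (auto simp: \<alpha> powr_realpow eventually_at_filter)
    from main[OF X(1) _ X(2) this] I N \<alpha>
    \<comment> \<open>With \<open>\<alpha> = m\<close> the binomial coefficient and the limit
      \<open>l\<close> are 1, and the power of 2 is 1.\<close>
    have "0 \<le> -1/2 + (1 - 2 * (1 / P))\<^sup>2 / 2"
      by (simp add: binomial_gbinomial[symmetric])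
    moreover have "\<bar>1 - 2 * (1 / P)\<bar> < 1" using \<open>1 < P\<close> by (simp add: abs_if field_simps)
    then have "(1 - 2 * (1 / P))\<^sup>2 < 1" by (simp add: abs_square_less_1)
    ultimately show False by simp
  qed
qed

text \<open>Super-additivity kills every divided difference of \<open>f x / x\<close> over
  \<open>m + 1\<close> nonzero nodes in \<open>I\<close>. With nodes 1, ..., m fixed and the last
  one varying, \<open>f x / x\<close> is a polynomial, hence \<open>f\<close> is one on
  \<open>I\<close>.\<close>

lemma superadditive_kernel_imp_monomial:
  assumes super: "\<And>X e w. finite X \<Longrightarrow> X \<subseteq> I \<Longrightarrow> X \<noteq> {} \<Longrightarrow> card X \<le> n \<Longrightarrow> 0 < e \<Longrightarrow>
       0 \<le> qform X (\<lambda>x y. f (1 + e * (x * y)) - (f 1 + f (e * (x * y)))) w"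
    and small: "\<alpha> < real n"
  shows "\<exists>m. \<alpha> = real m \<and> (\<forall>x\<in>I. f x = x ^ m)"
proof (rule ccontr)
  assume neg: "\<not> ?thesis"
  define m where "m = nat \<lfloor>\<alpha>\<rfloor>"
  have m: "real m \<le> \<alpha>" "\<alpha> < real m + 1" using exponent_pos unfolding m_def by linarith+
  have mn: "Suc m \<le> n" using m small by linarith
  define Y where "Y = real ` {1..m}"
  have Y: "finite Y" "card Y = m" "\<And>y. y \<in> Y \<Longrightarrow> 1 \<le> y"
    by (auto simp: Y_def card_image)
  obtain q where q: "\<forall>y\<in>Y. poly q y = f y / y" "\<forall>k\<ge>card Y. coeff q k = 0"
    using lagrange_interpolation[OF Y(1), of "\<lambda>y. f y / y"] by blast
  have "\<not> (\<forall>x\<in>I. f x = poly (pCons 0 q) x)"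
    using polynomial_imp_monomial[of "pCons 0 q"] neg by blast
  then obtain x0 where x0: "x0 \<in> I" "f x0 \<noteq> x0 * poly q x0" by auto
  have "x0 \<noteq> 0" using x0 nonneg_arg[of 0] by auto
  have "x0 \<notin> Y" using x0 q(1) \<open>x0 \<noteq> 0\<close> by auto
  define X where "X = insert x0 Y"
  have X: "finite X" "card X = Suc m" using Y \<open>x0 \<notin> Y\<close> by (auto simp: X_def)
  have XI: "X \<subseteq> I" using x0 Y(3) nonneg_in_domain by (force simp: X_def)
  have nz: "x \<noteq> 0" if "x \<in> X" for x using that Y(3)[of x] \<open>x0 \<noteq> 0\<close> by (auto simp: X_def)
  let ?w = "divided_difference_weight X"
  \<comment> \<open>Dividing the weights by \<open>x\<close> shifts the vanishing moments from
    orders 0 to m-1 to orders 1 to m.\<close>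
  have "(\<Sum>x\<in>X. ?w x / x * f x) = 0"
  proof (rule superadditive_kernel_moment[OF X(1) XI])
    fix k assume k: "1 \<le> k" "k \<le> m"
    have "(\<Sum>x\<in>X. ?w x / x * x ^ k) = (\<Sum>x\<in>X. ?w x * x ^ (k - 1))"
      using nz k by (intro sum.cong refl) (auto simp: power_eq_if)
    then show "(\<Sum>x\<in>X. ?w x / x * x ^ k) = 0"
      using divided_difference_power[OF X, of "k - 1"] k by auto
  next
    fix e :: real assume "0 < e"
    then show "0 \<le> qform X (\<lambda>x y. f (1 + e * (x * y)) - (f 1 + f (e * (x * y)))) (\<lambda>x. ?w x / x)"
      using X mn by (intro super[OF X(1) XI]) auto
  qed (use m in auto)
  moreover have "(\<Sum>x\<in>X. ?w x * poly q x) = 0"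
    using divided_difference_poly[OF X(1), of q] q(2) X Y by simp
  ultimately have "(\<Sum>x\<in>X. ?w x * (f x / x - poly q x)) = 0"
    by (simp add: right_diff_distrib sum_subtractf)
  moreover have "(\<Sum>x\<in>Y. ?w x * (f x / x - poly q x)) = 0"
    by (intro sum.neutral ballI) (simp add: q)
  \<comment> \<open>\<open>q\<close> interpolates on \<open>Y\<close>, so only the term at
    \<open>x0\<close> survives.\<close>
  ultimately have "?w x0 * (f x0 / x0 - poly q x0) = 0"
    using Y(1) \<open>x0 \<notin> Y\<close> by (simp add: X_def)
  moreover have "?w x0 \<noteq> 0" using X(1) by (simp add: divided_difference_weight_def)
  ultimately show False using x0 \<open>x0 \<noteq> 0\<close> by (simp add: field_simps)
qed

end

section \<open>From matrices to kernels\<close>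

lemma qform_UNIV_eq_inner:
  fixes A :: "real ^ 'n ^ 'n"
  shows "qform UNIV (\<lambda>i j. A $ i $ j) (\<lambda>i. x $ i) = x \<bullet> (A *v x)"
  by (simp add: qform_def inner_vec_def matrix_vector_mult_def sum_distrib_left ac_simps)

lemma psd_matrices_iff_psd_on:
  fixes A :: "real ^ 'n ^ 'n"
  shows "A \<in> psd_matrices I \<longleftrightarrow> psd_on UNIV (\<lambda>i j. A $ i $ j) \<and> (\<forall>i j. A $ i $ j \<in> I)"
proof -
  have "transpose A = A \<longleftrightarrow> (\<forall>i j. A $ i $ j = A $ j $ i)"
    by (auto simp: transpose_def vec_eq_iff)
  moreover have "(\<forall>x. 0 \<le> x \<bullet> (A *v x)) \<longleftrightarrow> (\<forall>x. 0 \<le> qform UNIV (\<lambda>i j. A $ i $ j) x)"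
  proof safe
    fix x :: "'n \<Rightarrow> real"
    assume "\<forall>x. 0 \<le> x \<bullet> (A *v x)"
    then have "0 \<le> (\<chi> i. x i) \<bullet> (A *v (\<chi> i. x i))" by blast
    then show "0 \<le> qform UNIV (\<lambda>i j. A $ i $ j) x"
      unfolding qform_UNIV_eq_inner[symmetric] by (simp add: qform_def)
  qed (simp add: qform_UNIV_eq_inner[symmetric])
  ultimately show ?thesis by (auto simp: psd_matrices_def psd_on_def)
qed

lemma loewner_le_iff_psd_on:
  fixes A B :: "real ^ 'n ^ 'n"
  shows "loewner_le B A \<longleftrightarrow> psd_on UNIV (\<lambda>i j. A $ i $ j - B $ i $ j)"
  by (simp add: loewner_le_def psd_matrices_iff_psd_on)

lemma map_matrix_nth: "map_matrix f A $ i $ j = f (A $ i $ j)"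
  by (simp add: map_matrix_def)

text \<open>One chosen index per node turns the kernel on \<open>X\<close> into a principal block of
  the possibly larger matrix with repeated nodes.\<close>

lemma qform_nonneg_of_psd_pullback:
  assumes fin: "finite X" and ran: "range y = X"
    and psd: "psd_on (UNIV :: 'n::finite set) (\<lambda>i j. K (y i) (y j))"
  shows "0 \<le> qform X K w"
proof -
  let ?h = "inv_into UNIV y"
  have inj: "inj_on ?h X" using ran by (metis inj_on_inv_into subset_refl)
  have yh: "y (?h x) = x" if "x \<in> X" for x using that ran by (simp add: f_inv_into_f)
  have "psd_on (?h ` X) (\<lambda>i j. K (y i) (y j))" by (rule psd_on_subset[OF psd]) auto
  then have "0 \<le> qform (?h ` X) (\<lambda>i j. K (y i) (y j)) (\<lambda>i. w (y i))" by (rule qform_nonneg)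
  also have "\<dots> = qform X K w"
    unfolding qform_def using inj by (simp add: sum.reindex yh)
  finally show ?thesis .
qed

lemma finite_set_as_range:
  assumes "finite X" "X \<noteq> {}" "card X \<le> CARD('n::finite)"
  obtains y :: "'n::finite \<Rightarrow> 'a" where "range y = X"
proof -
  obtain h :: "'a \<Rightarrow> 'n::finite" where h: "inj_on h X"
    using card_le_inj[OF assms(1) finite_class.finite_UNIV assms(3)] by blast
  obtain a where a: "a \<in> X" using assms(2) by blast
  have "range (\<lambda>i. if i \<in> h ` X then inv_into X h i else a) = X"
  proof safe
    fix x assume x: "x \<in> X"
    then have "x = (if h x \<in> h ` X then inv_into X h (h x) else a)" using h by simp
    then show "x \<in> range (\<lambda>i. if i \<in> h ` X then inv_into X h i else a)" by blast
  qed (use a in \<open>auto simp: inv_into_into\<close>)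
  then show thesis by (rule that)
qed

definition affine_rank1 :: "real \<Rightarrow> real \<Rightarrow> ('n \<Rightarrow> real) \<Rightarrow> real ^ 'n ^ 'n" where
  "affine_rank1 c e y = (\<chi> i j. c + e * (y i * y j))"

lemma affine_rank1_nth: "affine_rank1 c e y $ i $ j = c + e * (y i * y j)"
  by (simp add: affine_rank1_def)

text \<open>The rows lie in the span of the all-ones vector and \<open>y\<close>; hence the test
  matrices are admissible as soon as \<open>2 \<le> k\<close>.\<close>

lemma rank_affine_rank1_le_2:
  fixes y :: "'n::finite \<Rightarrow> real"
  shows "rank (affine_rank1 c e y) \<le> 2"
proof -
  let ?u = "(\<chi> j. 1) :: real ^ 'n" and ?v = "(\<chi> j. y j) :: real ^ 'n"
  have "row i (affine_rank1 c e y) = c *\<^sub>R ?u + (e * y i) *\<^sub>R ?v" for i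
    by (simp add: vec_eq_iff row_def affine_rank1_nth)
  then have "rows (affine_rank1 c e y) \<subseteq> span {?u, ?v}"
    unfolding rows_def by (force intro: span_add span_scale span_base)
  then have "dim (rows (affine_rank1 c e y)) \<le> card {?u, ?v}"
    by (intro dim_le_card) auto
  also have "\<dots> \<le> 2" by (simp add: card_insert_if)
  finally show ?thesis by (simp add: row_rank_def)
qed

context power_function
begin

lemma affine_rank1_in_psd_matrices_rank:
  assumes "0 \<le> c" "0 \<le> e" "range y \<subseteq> I" "2 \<le> k"
  shows "affine_rank1 c e y \<in> psd_matrices_rank k I"
proof -
  have "psd_on UNIV (\<lambda>i j. c * (1 * 1) + e * (y i * y j))"
    by (intro psd_on_add psd_on_scale psd_on_rank1 assms)
  moreover have "(\<lambda>i j. c * (1 * 1) + e * (y i * y j)) = (\<lambda>i j. affine_rank1 c e y $ i $ j)"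
    by (intro ext) (simp add: affine_rank1_nth)
  ultimately have "psd_on UNIV (\<lambda>i j. affine_rank1 c e y $ i $ j)" by simp
  moreover have "affine_rank1 c e y $ i $ j \<in> I" for i j
    unfolding affine_rank1_nth using assms by (intro add_in_domain mult_in_domain) (auto intro: nonneg_in_domain)
  moreover have "rank (affine_rank1 c e y) \<le> k"
    using rank_affine_rank1_le_2[of c e y] assms(4) by linarith
  ultimately show ?thesis
    by (auto simp: psd_matrices_rank_def psd_matrices_iff_psd_on)
qed

lemma loewner_convex_imp_kernel:
  assumes conv: "loewner_convex_on (psd_matrices_rank k I :: (real ^ 'n ^ 'n) set) f" and k: "2 \<le> k"
    and X: "finite X" "X \<subseteq> I" "X \<noteq> {}" "card X \<le> CARD('n)" and e: "0 < e"
  shows "0 \<le> qform X (\<lambda>x y. 1/2 * f (1 + e * (x * y)) + 1/2 * f (e * (x * y)) - f (1/2 + e * (x * y))) w"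
proof -
  obtain y :: "'n \<Rightarrow> real" where y: "range y = X" using finite_set_as_range[OF X(1,3,4)] .
  let ?A = "affine_rank1 1 e y" and ?B = "affine_rank1 0 e y"
  have AB: "?A \<in> psd_matrices_rank k I" "?B \<in> psd_matrices_rank k I"
    using e k X y by (intro affine_rank1_in_psd_matrices_rank; simp)+
  \<comment> \<open>The difference is the all-ones matrix.\<close>
  have "loewner_le ?B ?A"
    using psd_on_rank1[of UNIV "\<lambda>_. 1"] by (simp add: loewner_le_iff_psd_on affine_rank1_nth)
  moreover have "loewner_le 0 ?B"
    using AB(2) by (simp add: loewner_le_iff_psd_on psd_matrices_rank_def psd_matrices_iff_psd_on)
  moreover have "(1/2 :: real) \<in> {0..1}" by simp
  ultimately have "loewner_le (map_matrix f ((1/2) *\<^sub>R ?A + (1 - 1/2) *\<^sub>R ?B))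
      ((1/2) *\<^sub>R map_matrix f ?A + (1 - 1/2) *\<^sub>R map_matrix f ?B)"
    using conv AB unfolding loewner_convex_on_def by blast
  then have "psd_on UNIV (\<lambda>i j. 1/2 * f (1 + e * (y i * y j)) + 1/2 * f (e * (y i * y j))
      - f (1/2 * (1 + e * (y i * y j)) + 1/2 * (e * (y i * y j))))"
    by (simp add: loewner_le_iff_psd_on map_matrix_nth affine_rank1_nth)
  also have "(\<lambda>i j. 1/2 * (1 + e * (y i * y j)) + 1/2 * (e * (y i * y j))) = (\<lambda>i j. 1/2 + e * (y i * y j))"
    by (simp add: field_simps)
  finally show ?thesis
    by (intro qform_nonneg_of_psd_pullback[OF X(1) y]) (simp add: field_simps)
qed

lemma loewner_super_additive_imp_kernel:
  assumes super: "loewner_super_additive_on I (psd_matrices_rank k I :: (real ^ 'n ^ 'n) set) f"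
    and k: "2 \<le> k"
    and X: "finite X" "X \<subseteq> I" "X \<noteq> {}" "card X \<le> CARD('n)" and e: "0 < e"
  shows "0 \<le> qform X (\<lambda>x y. f (1 + e * (x * y)) - (f 1 + f (e * (x * y)))) w"
proof -
  obtain y :: "'n \<Rightarrow> real" where y: "range y = X" using finite_set_as_range[OF X(1,3,4)] .
  let ?A = "affine_rank1 1 0 y" and ?B = "affine_rank1 0 e y"
  have AB: "?A \<in> psd_matrices_rank k I" "?B \<in> psd_matrices_rank k I"
    using e k X y by (intro affine_rank1_in_psd_matrices_rank; simp)+
  then have "\<forall>i j. (?A + ?B) $ i $ j \<in> I"
    by (auto simp: psd_matrices_rank_def psd_matrices_iff_psd_on intro: add_in_domain)
  then have "loewner_le (map_matrix f ?A + map_matrix f ?B) (map_matrix f (?A + ?B))"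
    using super AB unfolding loewner_super_additive_on_def by blast
  then have "psd_on UNIV (\<lambda>i j. f (1 + e * (y i * y j)) - (f 1 + f (e * (y i * y j))))"
    by (simp add: loewner_le_iff_psd_on map_matrix_nth affine_rank1_nth)
  then show ?thesis by (rule qform_nonneg_of_psd_pullback[OF X(1) y])
qed

text \<open>\<open>F\<close> agrees with \<open>f\<close> on \<open>I\<close> and satisfies the
  kernel inequality on all reals; this carries results on monomials and entire powers over to
  \<open>f_pow\<close>.\<close>

lemma loewner_convex_onI:
  assumes F: "\<And>x. x \<in> I \<Longrightarrow> f x = F x"
    and conv: "\<And>A B t. psd_on UNIV (\<lambda>i j. A i j - B i j) \<Longrightarrow> psd_on UNIV B \<Longrightarrow> 0 \<le> t \<Longrightarrow> t \<le> 1 \<Longrightarrow>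
      psd_on (UNIV :: 'n set) (\<lambda>i j. t * F (A i j) + (1 - t) * F (B i j) - F (t * A i j + (1 - t) * B i j))"
  shows "loewner_convex_on (psd_matrices_rank k I :: (real ^ 'n ^ 'n) set) f"
  unfolding loewner_convex_on_def
proof (intro ballI impI)
  fix A B :: "real ^ 'n ^ 'n" and t :: real
  assume A: "A \<in> psd_matrices_rank k I" and B: "B \<in> psd_matrices_rank k I"
    and t: "t \<in> {0..1}" and le: "loewner_le B A" "loewner_le 0 B"
  have in_I: "A $ i $ j \<in> I" "B $ i $ j \<in> I" for i j
    using A B by (auto simp: psd_matrices_rank_def psd_matrices_iff_psd_on)
  then have "t * A $ i $ j + (1 - t) * B $ i $ j \<in> I" for i j
    using t by (intro add_in_domain mult_in_domain) (auto intro: nonneg_in_domain)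
  then show "loewner_le (map_matrix f (t *\<^sub>R A + (1 - t) *\<^sub>R B))
               (t *\<^sub>R map_matrix f A + (1 - t) *\<^sub>R map_matrix f B)"
    using conv[of "\<lambda>i j. A $ i $ j" "\<lambda>i j. B $ i $ j" t] le t in_I
    by (simp add: loewner_le_iff_psd_on map_matrix_nth F)
qed

lemma loewner_super_additive_onI:
  assumes F: "\<And>x. x \<in> I \<Longrightarrow> f x = F x"
    and super: "\<And>A B. psd_on UNIV A \<Longrightarrow> psd_on UNIV B \<Longrightarrow>
      psd_on (UNIV :: 'n set) (\<lambda>i j. F (A i j + B i j) - (F (A i j) + F (B i j)))"
  shows "loewner_super_additive_on I (psd_matrices_rank k I :: (real ^ 'n ^ 'n) set) f"
  unfolding loewner_super_additive_on_def
proof (intro ballI impI)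
  fix A B :: "real ^ 'n ^ 'n"
  assume A: "A \<in> psd_matrices_rank k I" and B: "B \<in> psd_matrices_rank k I"
    and sum: "\<forall>i j. (A + B) $ i $ j \<in> I"
  show "loewner_le (map_matrix f A + map_matrix f B) (map_matrix f (A + B))"
    using super[of "\<lambda>i j. A $ i $ j" "\<lambda>i j. B $ i $ j"] A B sum
    by (simp add: loewner_le_iff_psd_on map_matrix_nth F psd_matrices_rank_def psd_matrices_iff_psd_on)
qed

end

theorem corollary5p2:
  fixes \<alpha> :: real and k :: nat and f :: "real \<Rightarrow> real" and I :: "real set"
  assumes "\<alpha> > 0"
    and "2 \<le> k" and "k \<le> CARD('n::finite)"
    and "(f = f_pow \<alpha> \<and> I = {0..}) \<or> (f = phi_pow \<alpha> \<and> I = UNIV) \<or> (f = psi_pow \<alpha> \<and> I = UNIV)"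
  shows "loewner_convex_on (psd_matrices_rank k I :: (real ^ 'n ^ 'n) set) f \<longleftrightarrow>
         loewner_super_additive_on I (psd_matrices_rank k I :: (real ^ 'n ^ 'n) set) f"
proof -
  interpret power_function I f \<alpha>
  proof
    show "I = {0..} \<or> I = UNIV" "0 < \<alpha>" using assms by auto
    show "f x = x powr \<alpha>" if "0 \<le> x" for x
      using assms(4) that by (auto simp: f_pow_def phi_pow_nonneg_arg psi_pow_nonneg_arg)
    show "f (x * y) = f x * f y" if "x \<in> I" "y \<in> I" for x y
      using assms(4) that by (auto simp: f_pow_def phi_pow_mult psi_pow_mult powr_mult)
  qed
  let ?mono = "\<exists>m. \<alpha> = real m \<and> (\<forall>x\<in>I. f x = x ^ m)"
  let ?conv = "loewner_convex_on (psd_matrices_rank k I :: (real ^ 'n ^ 'n) set) f"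
  let ?super = "loewner_super_additive_on I (psd_matrices_rank k I :: (real ^ 'n ^ 'n) set) f"
  have convD: "?mono" if "?conv" "\<alpha> < CARD('n)"
    by (rule convex_kernel_imp_monomial[OF loewner_convex_imp_kernel[OF that(1) assms(2)] that(2)])
  have superD: "?mono" if "?super" "\<alpha> < CARD('n)"
    by (rule superadditive_kernel_imp_monomial
        [OF loewner_super_additive_imp_kernel[OF that(1) assms(2)] that(2)])
  have monoI: "?conv \<and> ?super" if ?mono
  proof -
    from that obtain m where m: "\<alpha> = real m" "\<And>x. x \<in> I \<Longrightarrow> f x = x ^ m" by blast
    from m(1) have "1 \<le> m" using assms(1) by simp
    have ?conv
      by (intro loewner_convex_onI[OF m(2)] psd_on_power_convex) (use \<open>1 \<le> m\<close> in simp_all)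
    moreover have ?super
      by (intro loewner_super_additive_onI[OF m(2)] psd_on_power_superadditive) (use \<open>1 \<le> m\<close> in simp_all)
    ultimately show ?thesis ..
  qed
  have largeI: "?conv \<and> ?super" if large: "CARD('n) \<le> \<alpha>"
  proof -
    \<comment> \<open>On the half-line \<open>f_pow\<close> is replaced by
      \<open>phi_pow\<close>.\<close>
    obtain F where F: "F \<in> entire_powers \<alpha>" "\<And>x. x \<in> I \<Longrightarrow> f x = F x"
    proof (cases "f = f_pow \<alpha> \<and> I = {0..}")
      case True
      show thesis by (rule that[of "phi_pow \<alpha>"])
        (use True in \<open>auto simp: entire_powers_def f_pow_def phi_pow_def\<close>)
    next
      case False
      show thesis by (rule that[of f]) (use False assms(4) in \<open>auto simp: entire_powers_def\<close>)
    qed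
    have \<alpha>1: "1 \<le> \<alpha>" using large assms by linarith
    have ?conv
    proof (rule loewner_convex_onI[OF F(2)])
      fix A B :: "'n \<Rightarrow> 'n \<Rightarrow> real" and t :: real
      assume AB: "psd_on UNIV (\<lambda>i j. A i j - B i j)" "psd_on UNIV B" and t: "0 \<le> t" "t \<le> 1"
      \<comment> \<open>Here \<open>D\<close> is \<open>A - B\<close>, so \<open>B + D\<close> is
        \<open>A\<close> and \<open>B + t D\<close> is the convex combination.\<close>
      from psd_on_entire_power_convex[OF _ this(1,2) F(1) \<alpha>1 _ t] large
      show "psd_on UNIV (\<lambda>i j. t * F (A i j) + (1 - t) * F (B i j) - F (t * A i j + (1 - t) * B i j))"
        by (simp add: algebra_simps)
    qed
    moreover have ?super
      by (intro loewner_super_additive_onI[OF F(2)] psd_on_entire_power_superadditive[OF _ _ _ F(1) \<alpha>1])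
        (use large in simp_all)
    ultimately show ?thesis ..
  qed
  show ?thesis
  proof (cases "\<alpha> < CARD('n)")
    case True
    then show ?thesis using convD superD monoI by blast
  next
    case False
    then show ?thesis using largeI by simp
  qed
qed

end
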